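(* Consider the linear time-varying system, cost functions, DAC class $\mathcal{M}$ and Algorithm OLC-FK described in the context, under the standing assumptions stated there. Let $T\ge 3$, choose the memory length $h=\left\lceil \frac{\log T}{\log\left(1/(1-\gamma)\right)}\right\rceil$ and the step size $$\eta=\frac{D}{\sqrt{G_f\,(G_f+L_f h^2)\,T}} .$$ Then the regret of OLC-FK with respect to the comparator class of fixed DAC policies with gains in $\mathcal{M}$ satisfies $$R_T\le \mathcal{O}\!\left(D\sqrt{G_f\,(G_f+L_f h^2)}\;T^{1/2}\right),$$ where the $\mathcal{O}(\cdot)$ hides factors that do not depend on $T$ (other than through $h$, $G_f$, $L_f$ as displayed).
   Context: System: $x_{t+1}=A_tx_t+B_tu_t+w_t$, $y_t=C_tx_t+e_t$, $x_1=0$, with $x_t\in\mathbb{R}^n$, $u_t\in\mathbb{R}^m$, $y_t\in\mathbb{R}^p$, $w_t\in\mathbb{R}^n$, $e_t\in\mathbb{R}^p$; set $w_\tau=0,u_\tau=0$ for $\tau\le 0$. Norms are Euclidean for vectors and Frobenius for matrices unless $\|\cdot\|_2$ (spectral norm) is written. Standing assumptions: there are constants $\kappa_a,\kappa_b,\kappa_w,\kappa_e>0$ and $\gamma\in(0,1)$ with, for all $t$ and all $k\ge 0$, $\|C_{t+k+1}A_{t+k}\cdots A_{t+1}B_t\|_2\le\kappa_a\kappa_b(1-\gamma)^k$, $\|C_{t+k+1}A_{t+k}\cdots A_{t+1}\|_2\le\kappa_a(1-\gamma)^k$ (for $k=0$ the product of $A$'s is empty), $\|B_t\|_2\le\kappa_b$,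 $\|w_t\|\le\kappa_w$, $\|e_t\|\le\kappa_e$. Costs $c_t:\mathbb{R}^p\times\mathbb{R}^m\to\mathbb{R}$ are convex and differentiable; with $z=(y,u)$, $z'=(y',u')$ and $R=\max\{\|z\|,\|z'\|,1\}$, $|c_t(y,u)-c_t(y',u')|\le LR\|z-z'\|$; and for every $d>0$, if $\|y\|,\|u\|\le d$ then $\|\nabla_y c_t(y,u)\|\le Gd$, $\|\nabla_u c_t(y,u)\|\le Gd$. The sequences $A_t,B_t,C_t,w_t,e_t,c_t$ are arbitrary (time varying) subject to these assumptions. Markov parameters: $G_t^{[1]}=C_tB_{t-1}$, $G_t^{[k]}=C_tA_{t-1}\cdots A_{t-k+1}B_{t-k}$ for $k\ge2$ (these are known to the algorithm in this theorem). DAC class: $\mathcal{M}=\{M=(M^{[1]},\dots,M^{[h]}):M^{[k]}\in\mathbb{R}^{m\times n},\ \|M^{[k]}\|\le\kappa_M\}$, $\|M\|$ the Frobenius norm of the concatenation, $D=\sup_{M_1,M_2\in\mathcal{M}}\|M_1-M_2\|$. For $M\in\mathcal{M}$, the fixed DAC policy plays $u_t=\sum_{k=1}^hM^{[k]}w_{t-k}$; denote its outputs/inputs by $y_t^M,u_t^M$. Regret of an algorithm producing $(y_t,u_t)$: $R_T=\sum_{t=1}^Tc_t(y_t,u_t)-\min_{M\in\mathcal{M}}\sum_{t=1}^Tc_t(y^M_t,u^M_t)$. Algorithm OLC-FK: pick $M_1\in\mathcal{M}$. At each $t=1,\dots,T$: apply $u_t=\sum_{k=1}^hM_t^{[k]}w_{t-k}$;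 then observe $y_t$, $c_t$, $w_t$; let $s_t=y_t-\sum_{k=1}^{t-1}G_t^{[k]}u_{t-k}$, and for $M\in\mathcal{M}$ let $u_\tau(M)=\sum_{i=1}^hM^{[i]}w_{\tau-i}$ and $F_t(M)=c_t\big(s_t+\sum_{k=1}^hG_t^{[k]}u_{t-k}(M),\,u_t(M)\big)$; update $M_{t+1}=\mathrm{Proj}_{\mathcal{M}}\big(M_t-\eta\nabla F_t(M_t)\big)$ (Euclidean projection). Constants: $\widetilde D=\max\{\kappa_M\kappa_wh+\frac{\kappa_a\kappa_w}{\gamma}+\kappa_e+\frac{\kappa_a\kappa_b\kappa_M\kappa_wh}{\gamma},1\}$, $L_f=L\widetilde D(\kappa_a\kappa_b\kappa_w\sqrt h+\kappa_w\sqrt h)$, $G_f=G\widetilde D\,h\,n\,m\left(\frac{\kappa_a\kappa_b\kappa_w}{\gamma}+\kappa_w\right)$. *)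

theory Defs
  imports "HOL-Analysis.Analysis"
begin

text \<open>Time indices are natural numbers; the system is run for t = 1, 2, ...
  Matrices are rendered as real^'cols^'rows, e.g. an m x n matrix is real^'n^'m.
  The norm of real^'n^'m is the Frobenius norm; the spectral norm of a matrix X
  is onorm (\<lambda>x. X *v x).\<close>

fun Aprod :: "(nat \<Rightarrow> real^('n::finite)^'n) \<Rightarrow> nat \<Rightarrow> nat \<Rightarrow> real^'n^'n" where
  "Aprod A t 0 = mat 1"
| "Aprod A t (Suc k) = A (t + Suc k) ** Aprod A t k"

definition markov :: "(nat \<Rightarrow> real^('n::finite)^'n) \<Rightarrow> (nat \<Rightarrow> real^('m::finite)^'n) \<Rightarrow> (nat \<Rightarrow> real^'n^('p::finite))
    \<Rightarrow> nat \<Rightarrow> nat \<Rightarrow> real^'m^'p" where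
  "markov A B C t k = C t ** Aprod A (t - k) (k - 1) ** B (t - k)"

definition wpast :: "(nat \<Rightarrow> real^('n::finite)) \<Rightarrow> nat \<Rightarrow> nat \<Rightarrow> real^'n" where
  "wpast w t i = (if i < t then w (t - i) else 0)"

text \<open>DAC input u_t(M) = sum_{i=1}^h M^[i] w_{t-i}; the parameter M is a function
  nat => (m x n matrix) whose relevant entries are M 1, ..., M h.
  (For t = 0 this gives 0, matching u_\<tau> = 0 for \<tau> \<le> 0.)\<close>
definition dac_u :: "(nat \<Rightarrow> real^('n::finite)^('m::finite)) \<Rightarrow> nat \<Rightarrow> (nat \<Rightarrow> real^'n) \<Rightarrow> nat \<Rightarrow> real^'m" where
  "dac_u M h w t = (\<Sum>i = 1..h. M i *v wpast w t i)"

text \<open>State trajectory: x_1 = 0, x_{t+1} = A_t x_t + B_t u_t + w_t (x_0 unused).\<close>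
primrec traj :: "(nat \<Rightarrow> real^('n::finite)^'n) \<Rightarrow> (nat \<Rightarrow> real^('m::finite)^'n) \<Rightarrow> (nat \<Rightarrow> real^'n)
    \<Rightarrow> (nat \<Rightarrow> real^'m) \<Rightarrow> nat \<Rightarrow> real^'n" where
  "traj A B w u 0 = 0"
| "traj A B w u (Suc t) = (if t = 0 then 0 else A t *v traj A B w u t + B t *v u t + w t)"

text \<open>The DAC class: M^[k] with Frobenius norm \<le> \<kappa>_M for k = 1..h
  (entries outside 1..h are fixed to 0, so that M is an h-tuple).\<close>
definition dacset :: "nat \<Rightarrow> real \<Rightarrow> (nat \<Rightarrow> real^('n::finite)^('m::finite)) set" where
  "dacset h \<kappa>M = {M. (\<forall>k\<in>{1..h}. norm (M k) \<le> \<kappa>M) \<and> (\<forall>k. k \<notin> {1..h} \<longrightarrow> M k = 0)}"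

definition dacnorm :: "nat \<Rightarrow> (nat \<Rightarrow> real^('n::finite)^('m::finite)) \<Rightarrow> real" where
  "dacnorm h M = sqrt (\<Sum>k = 1..h. (norm (M k))\<^sup>2)"

definition dac_diam :: "nat \<Rightarrow> real \<Rightarrow> ('n::finite) itself \<Rightarrow> ('m::finite) itself \<Rightarrow> real" where
  "dac_diam h \<kappa>M (_::'n itself) (_::'m itself) =
     Sup {dacnorm h (\<lambda>k. M1 k - M2 k) | (M1 :: nat \<Rightarrow> real^'n^'m) M2.
            M1 \<in> dacset h \<kappa>M \<and> M2 \<in> dacset h \<kappa>M}"

definition dac_proj :: "nat \<Rightarrow> real \<Rightarrow> (nat \<Rightarrow> real^('n::finite)^('m::finite)) \<Rightarrow> (nat \<Rightarrow> real^'n^'m)" where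
  "dac_proj h \<kappa>M X = (THE Y. Y \<in> dacset h \<kappa>M \<and>
      (\<forall>Z\<in>dacset h \<kappa>M. dacnorm h (\<lambda>k. X k - Y k) \<le> dacnorm h (\<lambda>k. X k - Z k)))"

definition Emat :: "('m::finite) \<Rightarrow> ('n::finite) \<Rightarrow> real^'n^'m" where
  "Emat a b = (\<chi> i j. if i = a \<and> j = b then 1 else 0)"

definition dacgrad :: "nat \<Rightarrow> ((nat \<Rightarrow> real^('n::finite)^('m::finite)) \<Rightarrow> real) \<Rightarrow> (nat \<Rightarrow> real^'n^'m)
    \<Rightarrow> (nat \<Rightarrow> real^'n^'m)" where
  "dacgrad h F M = (\<lambda>k. if k \<in> {1..h}
      then (\<chi> a b. deriv (\<lambda>s. F (M(k := M k + s *\<^sub>R Emat a b))) 0) else 0)"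

definition vgrad :: "(real^('k::finite) \<Rightarrow> real) \<Rightarrow> real^'k \<Rightarrow> real^'k" where
  "vgrad f x = (\<chi> i. deriv (\<lambda>s. f (x + s *\<^sub>R axis i 1)) 0)"

definition system_ok :: "real \<Rightarrow> real \<Rightarrow> real \<Rightarrow> real \<Rightarrow> real \<Rightarrow>
    (nat \<Rightarrow> real^('n::finite)^'n) \<Rightarrow> (nat \<Rightarrow> real^('m::finite)^'n) \<Rightarrow> (nat \<Rightarrow> real^'n^('p::finite))
    \<Rightarrow> (nat \<Rightarrow> real^'n) \<Rightarrow> (nat \<Rightarrow> real^'p) \<Rightarrow> bool" where
  "system_ok \<kappa>a \<kappa>b \<kappa>w \<kappa>e \<gamma> A B C w e \<longleftrightarrow>
     (\<forall>t\<ge>1. \<forall>k.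
        onorm (\<lambda>x. (C (t + k + 1) ** Aprod A t k ** B t) *v x) \<le> \<kappa>a * \<kappa>b * (1 - \<gamma>) ^ k \<and>
        onorm (\<lambda>x. (C (t + k + 1) ** Aprod A t k) *v x) \<le> \<kappa>a * (1 - \<gamma>) ^ k) \<and>
     (\<forall>t\<ge>1. onorm (\<lambda>x. B t *v x) \<le> \<kappa>b \<and> norm (w t) \<le> \<kappa>w \<and> norm (e t) \<le> \<kappa>e)"

definition cost_ok :: "real \<Rightarrow> real \<Rightarrow> (nat \<Rightarrow> real^('p::finite) \<Rightarrow> real^('m::finite) \<Rightarrow> real) \<Rightarrow> bool" where
  "cost_ok L G c \<longleftrightarrow>
     (\<forall>t\<ge>1.
        convex_on UNIV (\<lambda>z. c t (fst z) (snd z)) \<and>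
        (\<forall>z. (\<lambda>z. c t (fst z) (snd z)) differentiable (at z)) \<and>
        (\<forall>y u y' u'. \<bar>c t y u - c t y' u'\<bar>
            \<le> L * max (max (norm (y, u)) (norm (y', u'))) 1 * norm ((y, u) - (y', u'))) \<and>
        (\<forall>d>0. \<forall>y u. norm y \<le> d \<and> norm u \<le> d \<longrightarrow>
            norm (vgrad (\<lambda>y'. c t y' u) y) \<le> G * d \<and> norm (vgrad (\<lambda>u'. c t y u') u) \<le> G * d))"

definition alg_u :: "nat \<Rightarrow> (nat \<Rightarrow> real^('n::finite)) \<Rightarrow> (nat \<Rightarrow> nat \<Rightarrow> real^'n^('m::finite)) \<Rightarrow> nat \<Rightarrow> real^'m" where
  "alg_u h w Ms t = dac_u (Ms t) h w t"

definition alg_y :: "nat \<Rightarrow> (nat \<Rightarrow> real^('n::finite)^'n) \<Rightarrow> (nat \<Rightarrow> real^('m::finite)^'n) \<Rightarrow> (nat \<Rightarrow> real^'n^('p::finite))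
    \<Rightarrow> (nat \<Rightarrow> real^'n) \<Rightarrow> (nat \<Rightarrow> real^'p) \<Rightarrow> (nat \<Rightarrow> nat \<Rightarrow> real^'n^'m) \<Rightarrow> nat \<Rightarrow> real^'p" where
  "alg_y h A B C w e Ms t = C t *v traj A B w (alg_u h w Ms) t + e t"

definition pol_u :: "nat \<Rightarrow> (nat \<Rightarrow> real^('n::finite)) \<Rightarrow> (nat \<Rightarrow> real^'n^('m::finite)) \<Rightarrow> nat \<Rightarrow> real^'m" where
  "pol_u h w M t = dac_u M h w t"

definition pol_y :: "nat \<Rightarrow> (nat \<Rightarrow> real^('n::finite)^'n) \<Rightarrow> (nat \<Rightarrow> real^('m::finite)^'n) \<Rightarrow> (nat \<Rightarrow> real^'n^('p::finite))
    \<Rightarrow> (nat \<Rightarrow> real^'n) \<Rightarrow> (nat \<Rightarrow> real^'p) \<Rightarrow> (nat \<Rightarrow> real^'n^'m) \<Rightarrow> nat \<Rightarrow> real^'p" where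
  "pol_y h A B C w e M t = C t *v traj A B w (pol_u h w M) t + e t"

definition olc_F :: "nat \<Rightarrow> (nat \<Rightarrow> real^('n::finite)^'n) \<Rightarrow> (nat \<Rightarrow> real^('m::finite)^'n) \<Rightarrow> (nat \<Rightarrow> real^'n^('p::finite))
    \<Rightarrow> (nat \<Rightarrow> real^'n) \<Rightarrow> (nat \<Rightarrow> real^'p \<Rightarrow> real^'m \<Rightarrow> real)
    \<Rightarrow> (nat \<Rightarrow> real^'p) \<Rightarrow> (nat \<Rightarrow> real^'m) \<Rightarrow> nat \<Rightarrow> (nat \<Rightarrow> real^'n^'m) \<Rightarrow> real" where
  "olc_F h A B C w c y u t M =
     (let s = y t - (\<Sum>k = 1..t - 1. markov A B C t k *v u (t - k))
      in c t (s + (\<Sum>k = 1..h. markov A B C t k *v dac_u M h w (t - k))) (dac_u M h w t))"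

definition olc_run :: "nat \<Rightarrow> real \<Rightarrow> real \<Rightarrow> (nat \<Rightarrow> real^('n::finite)^'n) \<Rightarrow> (nat \<Rightarrow> real^('m::finite)^'n)
    \<Rightarrow> (nat \<Rightarrow> real^'n^('p::finite)) \<Rightarrow> (nat \<Rightarrow> real^'n) \<Rightarrow> (nat \<Rightarrow> real^'p)
    \<Rightarrow> (nat \<Rightarrow> real^'p \<Rightarrow> real^'m \<Rightarrow> real) \<Rightarrow> (nat \<Rightarrow> nat \<Rightarrow> real^'n^'m) \<Rightarrow> bool" where
  "olc_run h \<kappa>M \<eta> A B C w e c Ms \<longleftrightarrow>
     Ms 1 \<in> dacset h \<kappa>M \<and>
     (\<forall>t\<ge>1. Ms (t + 1) = dac_proj h \<kappa>M (\<lambda>k. Ms t k - \<eta> *\<^sub>R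
         dacgrad h (olc_F h A B C w c (alg_y h A B C w e Ms) (alg_u h w Ms) t) (Ms t) k))"

definition regret :: "nat \<Rightarrow> nat \<Rightarrow> real \<Rightarrow> (nat \<Rightarrow> real^('n::finite)^'n) \<Rightarrow> (nat \<Rightarrow> real^('m::finite)^'n)
    \<Rightarrow> (nat \<Rightarrow> real^'n^('p::finite)) \<Rightarrow> (nat \<Rightarrow> real^'n) \<Rightarrow> (nat \<Rightarrow> real^'p)
    \<Rightarrow> (nat \<Rightarrow> real^'p \<Rightarrow> real^'m \<Rightarrow> real) \<Rightarrow> (nat \<Rightarrow> nat \<Rightarrow> real^'n^'m) \<Rightarrow> real" where
  "regret T h \<kappa>M A B C w e c Ms =
     (\<Sum>t = 1..T. c t (alg_y h A B C w e Ms t) (alg_u h w Ms t))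
     - (INF M \<in> dacset h \<kappa>M. \<Sum>t = 1..T. c t (pol_y h A B C w e M t) (pol_u h w M t))"

definition Dtil :: "real \<Rightarrow> real \<Rightarrow> real \<Rightarrow> real \<Rightarrow> real \<Rightarrow> real \<Rightarrow> nat \<Rightarrow> real" where
  "Dtil \<kappa>a \<kappa>b \<kappa>w \<kappa>e \<gamma> \<kappa>M h =
     max (\<kappa>M * \<kappa>w * real h + \<kappa>a * \<kappa>w / \<gamma> + \<kappa>e + \<kappa>a * \<kappa>b * \<kappa>M * \<kappa>w * real h / \<gamma>) 1"

definition Lf :: "real \<Rightarrow> real \<Rightarrow> real \<Rightarrow> real \<Rightarrow> real \<Rightarrow> real \<Rightarrow> real \<Rightarrow> nat \<Rightarrow> real" where
  "Lf L \<kappa>a \<kappa>b \<kappa>w \<kappa>e \<gamma> \<kappa>M h =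
     L * Dtil \<kappa>a \<kappa>b \<kappa>w \<kappa>e \<gamma> \<kappa>M h * (\<kappa>a * \<kappa>b * \<kappa>w * sqrt (real h) + \<kappa>w * sqrt (real h))"

definition Gf :: "real \<Rightarrow> real \<Rightarrow> real \<Rightarrow> real \<Rightarrow> real \<Rightarrow> real \<Rightarrow> real \<Rightarrow> nat \<Rightarrow> nat \<Rightarrow> nat \<Rightarrow> real" where
  "Gf G \<kappa>a \<kappa>b \<kappa>w \<kappa>e \<gamma> \<kappa>M h n m =
     G * Dtil \<kappa>a \<kappa>b \<kappa>w \<kappa>e \<gamma> \<kappa>M h * real h * real n * real m * (\<kappa>a * \<kappa>b * \<kappa>w / \<gamma> + \<kappa>w)"

definition mem_len :: "real \<Rightarrow> nat \<Rightarrow> nat" where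
  "mem_len \<gamma> T = nat \<lceil>ln (real T) / ln (1 / (1 - \<gamma>))\<rceil>"

end

theory Submission
  imports Defs
begin

text \<open>The surrogate loss \<^term>\<open>olc_F\<close> is the cost composed with an affine map of the controller, because
  the observed \<open>s\<^sub>t\<close> is exactly the part of the output caused by the disturbances. Projected gradient
  descent on the surrogates has regret \<open>D\<^sup>2 / (2 \<eta>) + \<eta> T G\<^sub>f\<^sup>2 / 2\<close>. A surrogate differs from the
  incurred cost by the drift of the controller during the last \<open>h\<close> steps, at most \<open>k \<eta> G\<^sub>f\<close> over
  \<open>k\<close> steps, and by the Markov parameters beyond \<open>h\<close>, which are geometrically small; as
  \<open>(1 - \<gamma>)^h \<le> 1 / T\<close>, these cost \<open>\<eta> T G\<^sub>f\<^sup>2 / \<gamma>\<close> and \<open>2 \<kappa>\<^sub>M G\<^sub>f \<le> D G\<^sub>f\<close> in total. Cost differences are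
  estimated by convexity and the gradient bound instead of the Lipschitz condition, so everything is
  controlled by \<open>G\<^sub>f\<close>, and \<open>K = 2 + 1 / \<gamma>\<close> works.\<close>

section \<open>Gradients and tangents\<close>

text \<open>\<open>dacgrad\<close> and \<open>vgrad\<close> are built from one-variable
  \<open>deriv\<close>; restricting a Frechet derivative to a line is how their entries are
  evaluated.\<close>

lemma has_field_derivative_along_line:
  fixes f :: "'a::real_normed_vector \<Rightarrow> real"
  assumes "(f has_derivative f') (at x)"
  shows "((\<lambda>s. f (x + s *\<^sub>R v)) has_field_derivative f' v) (at 0)"
proof -
  interpret f': bounded_linear f' using assms by (rule has_derivative_bounded_linear)
  have line: "((\<lambda>s. x + s *\<^sub>R v) has_derivative (\<lambda>s. s *\<^sub>R v)) (at 0)"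
    by (auto intro!: derivative_eq_intros)
  have "((\<lambda>s. f (x + s *\<^sub>R v)) has_derivative (\<lambda>s. f' (s *\<^sub>R v))) (at 0)"
    using diff_chain_at[OF line, of f f'] assms by (simp add: o_def)
  then show ?thesis
    by (simp add: has_field_derivative_def f'.scaleR mult_commute_abs)
qed

lemma deriv_along_line:
  fixes f :: "'a::real_normed_vector \<Rightarrow> real"
  assumes "(f has_derivative f') (at x)"
  shows "deriv (\<lambda>s. f (x + s *\<^sub>R v)) 0 = f' v"
  using has_field_derivative_along_line[OF assms] by (rule DERIV_imp_deriv)

text \<open>On the line through \<open>x\<close> and \<open>y\<close> this is the one-variable
  tangent inequality between the parameters 0 and 1.\<close>

lemma convex_on_above_tangent:
  fixes f :: "'a::real_normed_vector \<Rightarrow> real"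
  assumes "convex_on UNIV f" and "(f has_derivative f') (at x)"
  shows "f x + f' (y - x) \<le> f y"
proof -
  let ?g = "\<lambda>s. f (x + s *\<^sub>R (y - x))"
  have "convex_on UNIV ?g"
  proof (rule convex_onI)
    fix t a b :: real
    assume t: "0 < t" "t < 1"
    have "x + ((1 - t) *\<^sub>R a + t *\<^sub>R b) *\<^sub>R (y - x)
        = (1 - t) *\<^sub>R (x + a *\<^sub>R (y - x)) + t *\<^sub>R (x + b *\<^sub>R (y - x))"
      by (simp add: algebra_simps)
    then show "?g ((1 - t) *\<^sub>R a + t *\<^sub>R b) \<le> (1 - t) * ?g a + t * ?g b"
      using convex_onD[OF assms(1), of t] t by simp
  qed simp
  from convex_on_imp_above_tangent[OF this, of 0 1]
  show ?thesis using has_field_derivative_along_line[OF assms(2), of "y - x"]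
    by fastforce
qed

lemma vgrad_inner:
  assumes "(f has_derivative f') (at x)"
  shows "vgrad f x \<bullet> v = f' v"
proof -
  interpret f': bounded_linear f' using assms by (rule has_derivative_bounded_linear)
  have "f' v = f' (\<Sum>i\<in>UNIV. v $ i *\<^sub>R axis i 1)"
    by (simp add: basis_expansion flip: scalar_mult_eq_scaleR)
  also have "\<dots> = (\<Sum>i\<in>UNIV. v $ i * f' (axis i 1))"
    by (simp add: f'.sum f'.scaleR)
  finally show ?thesis
    by (simp add: vgrad_def deriv_along_line[OF assms] inner_vec_def mult.commute)
qed

text \<open>Controllers are functions on all of \<open>nat\<close>, so the Euclidean structure on
  the entries \<open>1..h\<close> is set up by hand; \<open>dacnorm\<close> is the norm of this
  inner product.\<close>

definition dacinner :: "nat \<Rightarrow> (nat \<Rightarrow> real^('n::finite)^('m::finite)) \<Rightarrow> (nat \<Rightarrow> real^'n^'m) \<Rightarrow> real"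
  where "dacinner h M N = (\<Sum>k = 1..h. M k \<bullet> N k)"

lemma matrix_Emat_expansion:
  fixes X :: "real^('n::finite)^('m::finite)"
  shows "X = (\<Sum>a\<in>UNIV. \<Sum>b\<in>UNIV. X $ a $ b *\<^sub>R Emat a b)"
proof -
  have "(\<Sum>a\<in>UNIV. \<Sum>b\<in>UNIV. X $ a $ b *\<^sub>R Emat a b) $ i $ j = X $ i $ j" for i j
  proof -
    have "(\<Sum>a\<in>UNIV. \<Sum>b\<in>UNIV. X $ a $ b *\<^sub>R Emat a b) $ i $ j
        = (\<Sum>a\<in>UNIV. if a = i then \<Sum>b\<in>UNIV. if b = j then X $ a $ b else 0 else 0)"
      unfolding sum_component by (rule sum.cong) (auto simp: Emat_def if_distrib [of "(*) _"] cong: if_cong)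
    then show ?thesis by simp
  qed
  then show ?thesis by (simp add: vec_eq_iff)
qed

text \<open>Perturbing one matrix entry moves the argument of \<open>f\<close> along the direction
  \<open>\<Lambda> k (Emat a b)\<close>, so the partial derivatives are values of \<open>f'\<close>,
  and linearity reassembles them. Pairing with \<open>N\<close> avoids naming the adjoint of
  \<open>\<Lambda>\<close>.\<close>

lemma dacinner_dacgrad:
  fixes f :: "'a::real_normed_vector \<Rightarrow> real"
    and F :: "(nat \<Rightarrow> real^('n::finite)^('m::finite)) \<Rightarrow> real"
  assumes F: "\<And>M. F M = f (z + (\<Sum>i = 1..h. \<Lambda> i (M i)))"
    and lin: "\<And>i. linear (\<Lambda> i)"
    and deriv: "(f has_derivative f') (at (z + (\<Sum>i = 1..h. \<Lambda> i (M i))))"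
  shows "dacinner h (dacgrad h F M) N = f' (\<Sum>i = 1..h. \<Lambda> i (N i))"
proof -
  interpret f': bounded_linear f' using deriv by (rule has_derivative_bounded_linear)
  have entry: "dacgrad h F M k = (\<chi> a b. f' (\<Lambda> k (Emat a b)))" if k: "k \<in> {1..h}" for k
  proof -
    have "(\<Sum>i = 1..h. \<Lambda> i ((M(k := M k + s *\<^sub>R E)) i))
        = (\<Sum>i = 1..h. \<Lambda> i (M i)) + s *\<^sub>R \<Lambda> k E" for s E
    proof -
      have "(\<Sum>i = 1..h. \<Lambda> i ((M(k := M k + s *\<^sub>R E)) i))
          = (\<Sum>i = 1..h. \<Lambda> i (M i) + (if i = k then s *\<^sub>R \<Lambda> k E else 0))"
        by (rule sum.cong) (auto simp: linear_add[OF lin] linear_scale[OF lin])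
      then show ?thesis using k by (simp add: sum.distrib)
    qed
    then have "deriv (\<lambda>s. F (M(k := M k + s *\<^sub>R E))) 0 = f' (\<Lambda> k E)" for E
      using deriv_along_line[OF deriv, of "\<Lambda> k E"] by (simp add: F add.assoc)
    then show ?thesis using k by (simp add: dacgrad_def)
  qed
  have "dacgrad h F M k \<bullet> N k = f' (\<Lambda> k (N k))" if "k \<in> {1..h}" for k
  proof -
    have "f' (\<Lambda> k (N k)) = f' (\<Lambda> k (\<Sum>a\<in>UNIV. \<Sum>b\<in>UNIV. N k $ a $ b *\<^sub>R Emat a b))"
      by (simp flip: matrix_Emat_expansion)
    also have "\<dots> = (\<Sum>a\<in>UNIV. \<Sum>b\<in>UNIV. N k $ a $ b * f' (\<Lambda> k (Emat a b)))"
      by (simp add: linear_sum[OF lin] linear_scale[OF lin] f'.sum f'.scaleR)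
    finally show ?thesis
      by (simp add: entry[OF that] inner_vec_def mult.commute)
  qed
  then show ?thesis
    by (simp add: dacinner_def f'.sum)
qed

section \<open>The space of controllers\<close>

lemma dacnorm_nonneg: "0 \<le> dacnorm h M"
  by (simp add: dacnorm_def sum_nonneg)

lemma dacnorm_power2: "(dacnorm h M)\<^sup>2 = dacinner h M M"
  by (simp add: dacnorm_def dacinner_def sum_nonneg power2_norm_eq_inner)

lemma dacnorm_L2_set: "dacnorm h M = L2_set (\<lambda>k. norm (M k)) {1..h}"
  by (simp add: dacnorm_def L2_set_def)

lemma dacinner_le: "dacinner h M N \<le> dacnorm h M * dacnorm h N"
proof -
  have "dacinner h M N \<le> (\<Sum>k = 1..h. \<bar>norm (M k)\<bar> * \<bar>norm (N k)\<bar>)"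
    unfolding dacinner_def by (intro sum_mono) (simp add: norm_cauchy_schwarz)
  also have "\<dots> \<le> dacnorm h M * dacnorm h N"
    unfolding dacnorm_L2_set by (rule L2_set_mult_ineq)
  finally show ?thesis .
qed

lemma dacnorm_triangle: "dacnorm h (\<lambda>k. M k - N k) \<le> dacnorm h (\<lambda>k. M k - P k) + dacnorm h (\<lambda>k. P k - N k)"
proof -
  have "dacnorm h (\<lambda>k. M k - N k) \<le> L2_set (\<lambda>k. norm (M k - P k) + norm (P k - N k)) {1..h}"
    unfolding dacnorm_L2_set by (intro L2_set_mono) (auto intro: norm_diff_triangle_le)
  also have "\<dots> \<le> dacnorm h (\<lambda>k. M k - P k) + dacnorm h (\<lambda>k. P k - N k)"
    unfolding dacnorm_L2_set by (rule L2_set_triangle_ineq)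
  finally show ?thesis .
qed

lemma dacnorm_scale: "dacnorm h (\<lambda>k. a *\<^sub>R M k) = \<bar>a\<bar> * dacnorm h M"
  by (simp add: dacnorm_def power_mult_distrib real_sqrt_mult flip: sum_distrib_left)

lemma dacnorm_commute: "dacnorm h (\<lambda>k. M k - N k) = dacnorm h (\<lambda>k. N k - M k)"
  by (simp add: dacnorm_def norm_minus_commute)

text \<open>Cauchy-Schwarz against the constant sequence 1; this is where the factor
  \<open>sqrt h\<close> enters.\<close>

lemma sum_norm_le_dacnorm: "(\<Sum>k = 1..h. norm (M k)) \<le> sqrt h * dacnorm h M"
  using L2_set_mult_ineq[of "\<lambda>_. 1" "\<lambda>k. norm (M k)" "{1..h}"]
  by (simp add: dacnorm_L2_set) (simp add: L2_set_def)

text \<open>\<open>dacnorm h\<close> sees only the entries \<open>1..h\<close>; it separates points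
  because all other entries of members of \<open>dacset\<close> are 0.\<close>

lemma dacset_eqI:
  assumes "M \<in> dacset h \<kappa>M" "N \<in> dacset h \<kappa>M" "dacnorm h (\<lambda>k. M k - N k) = 0"
  shows "M = N"
proof
  fix k
  show "M k = N k"
  proof (cases "k \<in> {1..h}")
    case True
    then show ?thesis using assms(3) by (auto simp: dacnorm_L2_set L2_set_eq_0_iff)
  next
    case False
    then show ?thesis using assms(1,2) by (simp add: dacset_def)
  qed
qed

lemma dacnorm_diff_le_diam:
  fixes M N :: "nat \<Rightarrow> real^('n::finite)^('m::finite)"
  assumes "M \<in> dacset h \<kappa>M" "N \<in> dacset h \<kappa>M"
  shows "dacnorm h (\<lambda>k. M k - N k) \<le> dac_diam h \<kappa>M TYPE('n) TYPE('m)"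
proof -
  \<comment> \<open>\<open>Sup\<close> is an upper bound only for a set that is bounded above; a
    crude bound by \<open>2 * \<kappa>M\<close> per entry suffices.\<close>
  have "bdd_above {dacnorm h (\<lambda>k. M1 k - M2 k) | (M1 :: nat \<Rightarrow> real^'n^'m) M2.
            M1 \<in> dacset h \<kappa>M \<and> M2 \<in> dacset h \<kappa>M}"
  proof (rule bdd_aboveI, clarify)
    fix M1 M2 :: "nat \<Rightarrow> real^'n^'m"
    assume M: "M1 \<in> dacset h \<kappa>M" "M2 \<in> dacset h \<kappa>M"
    have "dacnorm h (\<lambda>k. M1 k - M2 k) \<le> (\<Sum>k = 1..h. norm (M1 k - M2 k))"
      unfolding dacnorm_L2_set by (rule L2_set_le_sum) simp
    also have "\<dots> \<le> (\<Sum>k = 1..h. 2 * \<kappa>M)"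
    proof (rule sum_mono)
      fix k assume k: "k \<in> {1..h}"
      then have "norm (M1 k) \<le> \<kappa>M" "norm (M2 k) \<le> \<kappa>M" using M by (auto simp: dacset_def)
      then show "norm (M1 k - M2 k) \<le> 2 * \<kappa>M"
        using norm_triangle_ineq4[of "M1 k" "M2 k"] by simp
    qed
    finally show "dacnorm h (\<lambda>k. M1 k - M2 k) \<le> (\<Sum>k = 1..h. 2 * \<kappa>M)" .
  qed
  then show ?thesis
    unfolding dac_diam_def using assms by (intro cSup_upper) auto
qed

text \<open>Controllers with \<open>X\<close> and \<open>- X\<close> in the first entry, where
  \<open>X\<close> has norm \<open>\<kappa>M\<close>, lie at this distance. It lets the truncation
  cost be charged to the diameter.\<close>

lemma diam_ge:
  assumes "1 \<le> h" "0 \<le> \<kappa>M"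
  shows "2 * \<kappa>M \<le> dac_diam h \<kappa>M TYPE('n::finite) TYPE('m::finite)"
proof -
  obtain X :: "real^'n^'m" where X: "norm X = \<kappa>M"
    using vector_choose_size[OF assms(2)] by blast
  let ?M = "\<lambda>a k. if k = 1 then a *\<^sub>R X else 0"
  have "(\<Sum>k = 1..h. (norm (?M 1 k - ?M (-1) k))\<^sup>2) = (\<Sum>k = 1..h. if k = 1 then (2 * \<kappa>M)\<^sup>2 else 0)"
    by (rule sum.cong) (auto simp flip: X scaleR_2)
  also have "\<dots> = (2 * \<kappa>M)\<^sup>2" using assms by simp
  finally have "dacnorm h (\<lambda>k. ?M 1 k - ?M (-1) k) = 2 * \<kappa>M"
    unfolding dacnorm_def using assms(2) by (simp only: real_sqrt_abs)
  moreover have "?M 1 \<in> dacset h \<kappa>M" "?M (-1) \<in> dacset h \<kappa>M"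
    using assms X by (auto simp: dacset_def)
  ultimately show ?thesis
    using dacnorm_diff_le_diam[of "?M 1" h \<kappa>M "?M (-1)"] by simp
qed

section \<open>Projected gradient descent\<close>

text \<open>\<open>dacset\<close> is a product of Frobenius balls, so the projection is given by the
  closest point in each entry.\<close>

lemma dac_proj:
  assumes "0 \<le> \<kappa>M"
  shows dac_proj_in: "dac_proj h \<kappa>M X \<in> dacset h \<kappa>M"
    and dac_proj_nonexpansive: "Z \<in> dacset h \<kappa>M \<Longrightarrow>
      dacnorm h (\<lambda>k. dac_proj h \<kappa>M X k - Z k) \<le> dacnorm h (\<lambda>k. X k - Z k)"
proof -
  define Y where "Y = (\<lambda>k. if k \<in> {1..h} then closest_point (cball 0 \<kappa>M) (X k) else 0)"
  have Y: "Y \<in> dacset h \<kappa>M"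
    using assms closest_point_in_set[of "cball 0 \<kappa>M"] by (auto simp: Y_def dacset_def)
  \<comment> \<open>The obtuse angle at each closest point, summed over the entries, gives a
    Pythagorean inequality. It yields minimality of \<open>Y\<close>, uniqueness of the minimizer
    and the final distance bound.\<close>
  have pyth: "(dacnorm h (\<lambda>k. X k - Y k))\<^sup>2 + (dacnorm h (\<lambda>k. Y k - Z k))\<^sup>2
      \<le> (dacnorm h (\<lambda>k. X k - Z k))\<^sup>2" if Z: "Z \<in> dacset h \<kappa>M" for Z
    unfolding dacnorm_power2 dacinner_def sum.distrib[symmetric]
  proof (rule sum_mono)
    fix k assume k: "k \<in> {1..h}"
    have "(X k - Y k) \<bullet> (Z k - Y k) \<le> 0"
      using closest_point_dot[of "cball 0 \<kappa>M" "Z k" "X k"] Z k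
      by (auto simp: Y_def dacset_def)
    then show "(X k - Y k) \<bullet> (X k - Y k) + (Y k - Z k) \<bullet> (Y k - Z k) \<le> (X k - Z k) \<bullet> (X k - Z k)"
      by (simp add: inner_diff inner_commute)
  qed
  have best: "dacnorm h (\<lambda>k. X k - Y k) \<le> dacnorm h (\<lambda>k. X k - Z k)" if "Z \<in> dacset h \<kappa>M" for Z
    using pyth[OF that] by (intro power2_le_imp_le[OF _ dacnorm_nonneg]) (smt (verit) zero_le_power2)
  have "dac_proj h \<kappa>M X = Y"
    unfolding dac_proj_def
  proof (rule the_equality)
    fix Z assume Z: "Z \<in> dacset h \<kappa>M \<and>
      (\<forall>Z'\<in>dacset h \<kappa>M. dacnorm h (\<lambda>k. X k - Z k) \<le> dacnorm h (\<lambda>k. X k - Z' k))"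
    then have "(dacnorm h (\<lambda>k. X k - Z k))\<^sup>2 \<le> (dacnorm h (\<lambda>k. X k - Y k))\<^sup>2"
      using Y by (intro power_mono dacnorm_nonneg) auto
    then have "dacnorm h (\<lambda>k. Y k - Z k) = 0" using pyth[of Z] Z by (smt (verit) power2_less_eq_zero_iff)
    then show "Z = Y" using dacset_eqI[OF Y, of Z] Z by simp
  qed (use Y best in blast)
  then show "dac_proj h \<kappa>M X \<in> dacset h \<kappa>M"
    and "Z \<in> dacset h \<kappa>M \<Longrightarrow> dacnorm h (\<lambda>k. dac_proj h \<kappa>M X k - Z k) \<le> dacnorm h (\<lambda>k. X k - Z k)"
    using Y pyth[of Z] by (auto intro!: power2_le_imp_le[OF _ dacnorm_nonneg])
      (smt (verit) zero_le_power2)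
qed

text \<open>Descent along arbitrary directions \<open>g t\<close>, detached from the losses. The
  bound on \<open>g t\<close> is conditional on a feasible iterate, so the locale can be entered
  before feasibility is known; \<open>iterate_in\<close> then obtains it from the
  projection.\<close>

locale projected_descent =
  fixes h :: nat and \<kappa>M \<eta> b :: real and g Ms :: "nat \<Rightarrow> nat \<Rightarrow> real^('n::finite)^('m::finite)"
  assumes \<kappa>M: "0 \<le> \<kappa>M" and \<eta>: "0 \<le> \<eta>"
    and init: "Ms 1 \<in> dacset h \<kappa>M"
    and step: "\<And>t. 1 \<le> t \<Longrightarrow> Ms (Suc t) = dac_proj h \<kappa>M (\<lambda>k. Ms t k - \<eta> *\<^sub>R g t k)"
    and bound: "\<And>t. 1 \<le> t \<Longrightarrow> Ms t \<in> dacset h \<kappa>M \<Longrightarrow> dacnorm h (g t) \<le> b"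
begin

lemma iterate_in: "1 \<le> t \<Longrightarrow> Ms t \<in> dacset h \<kappa>M"
  by (induction t rule: dec_induct) (auto simp: init[unfolded One_nat_def] step dac_proj_in[OF \<kappa>M])

lemma grad_le: "1 \<le> t \<Longrightarrow> dacnorm h (g t) \<le> b"
  using bound iterate_in by blast

text \<open>The current iterate is feasible, so projecting does not increase the distance to it: one
  update moves by at most \<open>\<eta> * b\<close>, and the triangle inequality adds these
  up.\<close>

lemma drift:
  assumes "1 \<le> s"
  shows "dacnorm h (\<lambda>k. Ms (s + d) k - Ms s k) \<le> real d * (\<eta> * b)"
proof (induction d)
  case 0
  then show ?case by (simp add: dacnorm_def)
next
  case (Suc d)
  have t: "1 \<le> s + d" using assms by simp
  have "dacnorm h (\<lambda>k. Ms (Suc (s + d)) k - Ms (s + d) k)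
      \<le> dacnorm h (\<lambda>k. (Ms (s + d) k - \<eta> *\<^sub>R g (s + d) k) - Ms (s + d) k)"
    unfolding step[OF t] by (rule dac_proj_nonexpansive[OF \<kappa>M iterate_in[OF t]])
  also have "\<dots> = dacnorm h (\<lambda>k. (- \<eta>) *\<^sub>R g (s + d) k)" by simp
  also have "\<dots> \<le> \<eta> * b"
    unfolding dacnorm_scale using \<eta> grad_le[OF t] by (simp add: mult_left_mono)
  finally show ?case
    using Suc dacnorm_triangle[of h "Ms (s + Suc d)" "Ms s" "Ms (s + d)"]
    by (simp add: algebra_simps)
qed

lemma descent_step:
  assumes "1 \<le> t" "Z \<in> dacset h \<kappa>M"
  shows "2 * \<eta> * dacinner h (g t) (\<lambda>k. Ms t k - Z k)
    \<le> (dacnorm h (\<lambda>k. Ms t k - Z k))\<^sup>2 - (dacnorm h (\<lambda>k. Ms (Suc t) k - Z k))\<^sup>2 + \<eta>\<^sup>2 * b\<^sup>2"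
proof -
  have "(dacnorm h (\<lambda>k. Ms (Suc t) k - Z k))\<^sup>2 \<le> (dacnorm h (\<lambda>k. (Ms t k - \<eta> *\<^sub>R g t k) - Z k))\<^sup>2"
    unfolding step[OF assms(1)]
    by (intro power_mono dacnorm_nonneg dac_proj_nonexpansive \<kappa>M assms)
  also have "\<dots> = (dacnorm h (\<lambda>k. Ms t k - Z k))\<^sup>2
      - 2 * \<eta> * dacinner h (g t) (\<lambda>k. Ms t k - Z k) + \<eta>\<^sup>2 * (dacnorm h (g t))\<^sup>2"
    unfolding dacnorm_power2 dacinner_def sum_distrib_left sum_subtractf[symmetric] sum.distrib[symmetric]
    by (rule sum.cong) (simp_all add: inner_diff inner_commute algebra_simps power2_eq_square)
  also have "\<eta>\<^sup>2 * (dacnorm h (g t))\<^sup>2 \<le> \<eta>\<^sup>2 * b\<^sup>2"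
    by (intro mult_left_mono power_mono grad_le assms dacnorm_nonneg) simp
  finally show ?thesis by linarith
qed

text \<open>The squared distances to \<open>Z\<close> in \<open>descent_step\<close> telescope; the
  last is dropped and the first is at most the squared diameter.\<close>

lemma descent_regret:
  assumes "Z \<in> dacset h \<kappa>M" "0 < \<eta>"
  shows "(\<Sum>t = 1..T. dacinner h (g t) (\<lambda>k. Ms t k - Z k))
    \<le> (dac_diam h \<kappa>M TYPE('n) TYPE('m))\<^sup>2 / (2 * \<eta>) + \<eta> * real T * b\<^sup>2 / 2"
proof -
  let ?d = "\<lambda>t. (dacnorm h (\<lambda>k. Ms t k - Z k))\<^sup>2"
  have "2 * \<eta> * (\<Sum>t = 1..T. dacinner h (g t) (\<lambda>k. Ms t k - Z k))
      \<le> ?d 1 - ?d (Suc T) + real T * (\<eta>\<^sup>2 * b\<^sup>2)"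
  proof (induction T)
    case (Suc T)
    then show ?case using descent_step[of "Suc T", OF _ assms(1)] by (simp add: algebra_simps)
  qed simp
  moreover have "?d 1 \<le> (dac_diam h \<kappa>M TYPE('n) TYPE('m))\<^sup>2"
    by (intro power_mono dacnorm_nonneg dacnorm_diff_le_diam init assms)
  ultimately have "2 * \<eta> * (\<Sum>t = 1..T. dacinner h (g t) (\<lambda>k. Ms t k - Z k))
      \<le> (dac_diam h \<kappa>M TYPE('n) TYPE('m))\<^sup>2 + real T * (\<eta>\<^sup>2 * b\<^sup>2)"
    by (smt (verit) zero_le_power2)
  then show ?thesis using assms(2) by (simp add: field_simps power2_eq_square)
qed

end

section \<open>Closed form of the output\<close>

text \<open>Cauchy-Schwarz in each row; \<open>norm X\<close> is the Frobenius norm, the one that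
  \<open>dacset\<close> bounds.\<close>

lemma norm_matrix_vector_le:
  fixes X :: "real^('n::finite)^('m::finite)"
  shows "norm (X *v x) \<le> norm X * norm x"
proof -
  have "norm (X *v x) \<le> L2_set (\<lambda>i. norm (X $ i) * norm x) UNIV"
    unfolding norm_vec_def[of "X *v x"]
    by (intro L2_set_mono) (auto simp: matrix_vector_mul_component Cauchy_Schwarz_ineq2)
  then show ?thesis
    by (simp add: norm_vec_def[of X] L2_set_left_distrib)
qed

text \<open>\<open>Aprod A (t - k) (k - 1)\<close> is the product of \<open>A (t - 1)\<close> down
  to \<open>A (t - k + 1)\<close>. Passing to \<open>Suc t\<close> multiplies every term by
  \<open>A t\<close>, which shifts its lag by one, and adds a new term of lag 1. For
  \<open>t \<le> 1\<close> both sides vanish.\<close>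

lemma traj_unroll:
  fixes A :: "nat \<Rightarrow> real^('n::finite)^'n"
  shows "traj A B w u t = (\<Sum>k = 1..t - 1. Aprod A (t - k) (k - 1) *v (B (t - k) *v u (t - k) + w (t - k)))"
proof (induction t)
  case (Suc t)
  show ?case
  proof (cases "t = 0")
    case False
    let ?v = "\<lambda>s. B s *v u s + w s"
    have shift: "Aprod A (Suc t - Suc k) (Suc k - 1) *v ?v (Suc t - Suc k)
        = A t *v (Aprod A (t - k) (k - 1) *v ?v (t - k))" if "k \<in> {1..t - 1}" for k
    proof -
      have "k = Suc (k - 1)" and "t - k + k = t" using that by auto
      then have "Aprod A (t - k) k = A t ** Aprod A (t - k) (k - 1)"
        using Aprod.simps(2)[of A "t - k" "k - 1"] by simp
      then show ?thesis by (simp add: matrix_vector_mul_assoc)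
    qed
    have "(\<Sum>k = 1..Suc t - 1. f k) = f 1 + (\<Sum>k = 1..t - 1. f (Suc k))" for f :: "nat \<Rightarrow> real^'n"
      using False sum.atLeast_Suc_atMost[of 1 t f] sum.shift_bounds_cl_Suc_ivl[of f 1 "t - 1"] by simp
    then have "(\<Sum>k = 1..Suc t - 1. Aprod A (Suc t - k) (k - 1) *v ?v (Suc t - k))
        = ?v t + (\<Sum>k = 1..t - 1. Aprod A (Suc t - Suc k) (Suc k - 1) *v ?v (Suc t - Suc k))"
      by simp
    also have "\<dots> = ?v t + (\<Sum>k = 1..t - 1. A t *v (Aprod A (t - k) (k - 1) *v ?v (t - k)))"
      using shift by (intro arg_cong2[of _ _ _ _ "(+)"] refl sum.cong)
    also have "\<dots> = traj A B w u (Suc t)"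
      using False by (simp add: Suc.IH linear_sum[OF matrix_vector_mul_linear])
    finally show ?thesis by simp
  qed simp
qed simp

text \<open>The output under zero input, common to all controllers; it is the closed form of the
  algorithm's signal \<open>s\<close>.\<close>

definition noise_output :: "(nat \<Rightarrow> real^('n::finite)^'n) \<Rightarrow> (nat \<Rightarrow> real^'n^('p::finite))
    \<Rightarrow> (nat \<Rightarrow> real^'n) \<Rightarrow> (nat \<Rightarrow> real^'p) \<Rightarrow> nat \<Rightarrow> real^'p" where
  "noise_output A C w e t = (\<Sum>k = 1..t - 1. (C t ** Aprod A (t - k) (k - 1)) *v w (t - k)) + e t"

text \<open>The number \<open>l\<close> of retained lags is a parameter: \<open>l = t - 1\<close>
  gives the true output, \<open>l = h\<close> the surrogate.\<close>

definition response :: "(nat \<Rightarrow> real^('n::finite)^'n) \<Rightarrow> (nat \<Rightarrow> real^('m::finite)^'n) \<Rightarrow> (nat \<Rightarrow> real^'n^('p::finite))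
    \<Rightarrow> nat \<Rightarrow> (nat \<Rightarrow> real^'m) \<Rightarrow> nat \<Rightarrow> real^'p" where
  "response A B C l u t = (\<Sum>k = 1..l. markov A B C t k *v u (t - k))"

lemma output_eq:
  "C t *v traj A B w u t + e t = noise_output A C w e t + response A B C (t - 1) u t"
  unfolding traj_unroll noise_output_def response_def markov_def
  by (simp add: linear_sum[OF matrix_vector_mul_linear] matrix_vector_mul_assoc
      matrix_vector_right_distrib matrix_mul_assoc sum.distrib)

lemma alg_y_eq:
  "alg_y h A B C w e Ms t = noise_output A C w e t + response A B C (t - 1) (alg_u h w Ms) t"
  by (simp add: alg_y_def output_eq)

lemma pol_y_eq:
  "pol_y h A B C w e M t = noise_output A C w e t + response A B C (t - 1) (dac_u M h w) t"
proof -
  have "pol_u h w M = dac_u M h w" by (simp add: fun_eq_iff pol_u_def)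
  then show ?thesis by (simp add: pol_y_def output_eq)
qed

text \<open>Subtracting the response to the played inputs from the observed output leaves exactly
  \<open>noise_output\<close>, so the loss at \<open>M\<close> does not depend on the iterates
  \<open>Ms\<close>.\<close>

lemma olc_F_eq:
  "olc_F h A B C w c (alg_y h A B C w e Ms) (alg_u h w Ms) t M
    = c t (noise_output A C w e t + response A B C h (dac_u M h w) t) (dac_u M h w t)"
  by (simp add: olc_F_def alg_y_eq response_def)

section \<open>Linearity in the input, and lags reaching back before the start\<close>

lemma dac_u_diff: "dac_u (\<lambda>k. M k - N k) h w t = dac_u M h w t - dac_u N h w t"
  by (simp add: dac_u_def matrix_vector_mult_diff_rdistrib sum_subtractf)

lemma dac_u_0: "dac_u M h w 0 = 0"
  by (simp add: dac_u_def wpast_def)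

lemma response_diff:
  "response A B C l (\<lambda>s. u s - v s) t = response A B C l u t - response A B C l v t"
  by (simp add: response_def matrix_vector_mult_diff_distrib sum_subtractf)

text \<open>Truncated subtraction sends every lag \<open>k \<ge> t\<close> to time 0, where
  \<open>v\<close> vanishes. What remains are the lags \<open>k < t\<close>, for which the decay
  bounds are available.\<close>

lemma response_le_horizon:
  assumes "v 0 = 0"
  shows "response A B C l v t = response A B C (min l (t - 1)) v t"
  unfolding response_def by (rule sum.mono_neutral_right) (use assms in auto)

section \<open>Geometric sums\<close>

text \<open>Multiplied by \<open>\<gamma>\<close>, the sum has a closed form; the \<open>max\<close>
  covers the empty sum for \<open>n \<le> l\<close>.\<close>

lemma geometric_tail:
  fixes \<gamma> :: real
  assumes "0 < \<gamma>" "\<gamma> < 1"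
  shows "(\<Sum>k = Suc l..n. (1 - \<gamma>) ^ (k - 1)) \<le> (1 - \<gamma>) ^ l / \<gamma>"
proof -
  have "\<gamma> * (\<Sum>k = Suc l..n. (1 - \<gamma>) ^ (k - 1)) = (1 - \<gamma>) ^ l - (1 - \<gamma>) ^ max l n"
  proof (induction n)
    case (Suc n)
    show ?case
    proof (cases "l \<le> n")
      case True
      then show ?thesis using Suc by (simp add: algebra_simps max_def split: if_splits)
    next
      case False
      then have "max l (Suc n) = l" by simp
      with False show ?thesis by simp
    qed
  qed simp
  then show ?thesis using assms by (simp add: pos_le_divide_eq mult.commute)
qed

lemma geometric_sum_le:
  fixes \<gamma> :: real
  assumes "0 < \<gamma>" "\<gamma> < 1"
  shows "(\<Sum>k = 1..n. (1 - \<gamma>) ^ (k - 1)) \<le> 1 / \<gamma>"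
  using geometric_tail[OF assms, of 0 n] by simp

text \<open>The weight \<open>k\<close> will be the number of steps over which the controller
  drifts. Multiplied by \<open>\<gamma>\<^sup>2\<close>, the sum has a closed form.\<close>

lemma geometric_deriv_sum_le:
  fixes \<gamma> :: real
  assumes "0 < \<gamma>" "\<gamma> < 1"
  shows "(\<Sum>k = 1..n. (1 - \<gamma>) ^ (k - 1) * real k) \<le> 1 / \<gamma>\<^sup>2"
proof -
  have "\<gamma>\<^sup>2 * (\<Sum>k = 1..n. (1 - \<gamma>) ^ (k - 1) * real k) = 1 - (1 - \<gamma>) ^ n - real n * \<gamma> * (1 - \<gamma>) ^ n"
    by (induction n) (simp_all add: algebra_simps power2_eq_square)
  also have "\<dots> \<le> 1"
  proof -
    have "0 \<le> (1 - \<gamma>) ^ n" "0 \<le> real n * \<gamma> * (1 - \<gamma>) ^ n" using assms by simp_all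
    then show ?thesis by linarith
  qed
  finally show ?thesis using assms by (simp add: pos_le_divide_eq mult.commute)
qed

section \<open>Bounds along the trajectory\<close>

text \<open>Despite the name, the matrices \<open>A\<close>, \<open>B\<close> and \<open>C\<close>
  depend on time.\<close>

locale lti_system =
  fixes \<kappa>a \<kappa>b \<kappa>w \<kappa>e \<gamma> :: real
    and A :: "nat \<Rightarrow> real^('n::finite)^'n" and B :: "nat \<Rightarrow> real^('m::finite)^'n"
    and C :: "nat \<Rightarrow> real^'n^('p::finite)" and w :: "nat \<Rightarrow> real^'n" and e :: "nat \<Rightarrow> real^'p"
  assumes pos: "0 < \<kappa>a" "0 < \<kappa>b" "0 < \<kappa>w" "0 < \<kappa>e" "0 < \<gamma>" "\<gamma> < 1"
    and sys: "system_ok \<kappa>a \<kappa>b \<kappa>w \<kappa>e \<gamma> A B C w e"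
begin

lemma norm_mult_vec_le: "norm (X *v v) \<le> a * norm v"
  if "onorm (\<lambda>x. X *v x) \<le> a" for X :: "real^'k^'l"
  using onorm[OF matrix_vector_mul_bounded_linear, of X v] that
  by (rule order_trans[OF _ mult_right_mono]) auto

text \<open>\<open>system_ok\<close> counts forward from a starting time; here that time is
  \<open>t - k\<close>, and \<open>k < t\<close> makes it at least 1.\<close>

lemma onorm_le:
  assumes "1 \<le> k" "k < t"
  shows "onorm (\<lambda>x. (C t ** Aprod A (t - k) (k - 1) ** B (t - k)) *v x) \<le> \<kappa>a * \<kappa>b * (1 - \<gamma>) ^ (k - 1)"
    and "onorm (\<lambda>x. (C t ** Aprod A (t - k) (k - 1)) *v x) \<le> \<kappa>a * (1 - \<gamma>) ^ (k - 1)"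
proof -
  have t: "(t - k) + (k - 1) + 1 = t" and "1 \<le> t - k" using assms by auto
  then have
    "onorm (\<lambda>x. (C ((t - k) + (k - 1) + 1) ** Aprod A (t - k) (k - 1) ** B (t - k)) *v x)
        \<le> \<kappa>a * \<kappa>b * (1 - \<gamma>) ^ (k - 1) \<and>
      onorm (\<lambda>x. (C ((t - k) + (k - 1) + 1) ** Aprod A (t - k) (k - 1)) *v x) \<le> \<kappa>a * (1 - \<gamma>) ^ (k - 1)"
    using sys unfolding system_ok_def by blast
  then show "onorm (\<lambda>x. (C t ** Aprod A (t - k) (k - 1) ** B (t - k)) *v x) \<le> \<kappa>a * \<kappa>b * (1 - \<gamma>) ^ (k - 1)"
    and "onorm (\<lambda>x. (C t ** Aprod A (t - k) (k - 1)) *v x) \<le> \<kappa>a * (1 - \<gamma>) ^ (k - 1)"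
    unfolding t by blast+
qed

lemma norm_markov_le:
  assumes "1 \<le> k" "k < t"
  shows "norm (markov A B C t k *v v) \<le> \<kappa>a * \<kappa>b * (1 - \<gamma>) ^ (k - 1) * norm v"
  unfolding markov_def by (rule norm_mult_vec_le[OF onorm_le(1)[OF assms]])

lemma norm_noise_term_le:
  assumes "1 \<le> k" "k < t"
  shows "norm ((C t ** Aprod A (t - k) (k - 1)) *v w (t - k)) \<le> \<kappa>a * (1 - \<gamma>) ^ (k - 1) * \<kappa>w"
proof -
  have 1: "1 \<le> t - k" using assms by auto
  have "norm ((C t ** Aprod A (t - k) (k - 1)) *v w (t - k)) \<le> \<kappa>a * (1 - \<gamma>) ^ (k - 1) * norm (w (t - k))"
    by (rule norm_mult_vec_le[OF onorm_le(2)[OF assms]])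
  also have "\<dots> \<le> \<kappa>a * (1 - \<gamma>) ^ (k - 1) * \<kappa>w"
    using sys 1 pos unfolding system_ok_def by (intro mult_left_mono) auto
  finally show ?thesis .
qed

lemma norm_noise_output_le:
  assumes "1 \<le> t"
  shows "norm (noise_output A C w e t) \<le> \<kappa>a * \<kappa>w / \<gamma> + \<kappa>e"
proof -
  have "norm (\<Sum>k = 1..t - 1. (C t ** Aprod A (t - k) (k - 1)) *v w (t - k))
      \<le> (\<Sum>k = 1..t - 1. \<kappa>a * (1 - \<gamma>) ^ (k - 1) * \<kappa>w)"
  proof (rule sum_norm_le)
    fix k assume "k \<in> {1..t - 1}"
    then have "1 \<le> k" "k < t" by auto
    then show "norm ((C t ** Aprod A (t - k) (k - 1)) *v w (t - k)) \<le> \<kappa>a * (1 - \<gamma>) ^ (k - 1) * \<kappa>w"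
      by (rule norm_noise_term_le)
  qed
  also have "\<dots> = \<kappa>a * \<kappa>w * (\<Sum>k = 1..t - 1. (1 - \<gamma>) ^ (k - 1))"
    by (simp add: sum_distrib_left mult_ac)
  also have "\<dots> \<le> \<kappa>a * \<kappa>w * (1 / \<gamma>)"
    using pos by (intro mult_left_mono geometric_sum_le) auto
  finally have "norm (\<Sum>k = 1..t - 1. (C t ** Aprod A (t - k) (k - 1)) *v w (t - k)) \<le> \<kappa>a * \<kappa>w / \<gamma>"
    by simp
  moreover have "norm (e t) \<le> \<kappa>e" using sys assms by (simp add: system_ok_def)
  ultimately show ?thesis unfolding noise_output_def by (rule norm_triangle_mono)
qed

text \<open>Stated for a set \<open>S\<close> of lags so as to serve both the retained lags and the
  discarded tail.\<close>

lemma norm_markov_sum_le: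
  assumes "S \<subseteq> {1..t - 1}" "\<And>k. k \<in> S \<Longrightarrow> norm (v (t - k)) \<le> b k"
  shows "norm (\<Sum>k\<in>S. markov A B C t k *v v (t - k)) \<le> \<kappa>a * \<kappa>b * (\<Sum>k\<in>S. (1 - \<gamma>) ^ (k - 1) * b k)"
  unfolding sum_distrib_left
proof (rule sum_norm_le)
  fix k assume k: "k \<in> S"
  then have "1 \<le> k" "k < t" using assms(1) by fastforce+
  then have "norm (markov A B C t k *v v (t - k)) \<le> \<kappa>a * \<kappa>b * (1 - \<gamma>) ^ (k - 1) * norm (v (t - k))"
    by (rule norm_markov_le)
  also have "\<dots> \<le> \<kappa>a * \<kappa>b * (1 - \<gamma>) ^ (k - 1) * b k"
    using pos assms(2)[OF k] by (intro mult_left_mono) auto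
  finally show "norm (markov A B C t k *v v (t - k)) \<le> \<kappa>a * \<kappa>b * ((1 - \<gamma>) ^ (k - 1) * b k)"
    by (simp add: mult_ac)
qed

lemma norm_response_le:
  assumes "v 0 = 0" "\<And>s. norm (v s) \<le> U" "0 \<le> U"
  shows "norm (response A B C l v t) \<le> \<kappa>a * \<kappa>b * U / \<gamma>"
proof -
  have "norm (response A B C l v t)
      \<le> \<kappa>a * \<kappa>b * (\<Sum>k = 1..min l (t - 1). (1 - \<gamma>) ^ (k - 1) * U)"
    unfolding response_le_horizon[of v, OF assms(1), of _ _ _ l] response_def[of _ _ _ "min l (t - 1)"]
    by (rule norm_markov_sum_le[where v = v]) (auto intro: assms(2))
  also have "\<dots> = \<kappa>a * \<kappa>b * ((\<Sum>k = 1..min l (t - 1). (1 - \<gamma>) ^ (k - 1)) * U)"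
    by (simp add: sum_distrib_right)
  also have "\<dots> \<le> \<kappa>a * \<kappa>b * (1 / \<gamma> * U)"
    using pos assms by (intro mult_left_mono mult_right_mono geometric_sum_le) auto
  finally show ?thesis by simp
qed

text \<open>On lags up to \<open>l\<close> the inputs differ by at most \<open>k * \<delta>\<close>,
  which sums to the term with \<open>\<gamma>\<^sup>2\<close>; lags beyond \<open>l\<close> occur
  only in the response to \<open>u\<close> and form a geometric tail.\<close>

lemma response_truncation_le:
  assumes "v 0 = 0" "0 \<le> U" "0 \<le> \<delta>"
    and U: "\<And>s. norm (u s) \<le> U"
    and \<delta>: "\<And>k. 1 \<le> k \<Longrightarrow> k < t \<Longrightarrow> norm (u (t - k) - v (t - k)) \<le> real k * \<delta>"
  shows "norm (response A B C (t - 1) u t - response A B C l v t)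
    \<le> \<kappa>a * \<kappa>b * (\<delta> / \<gamma>\<^sup>2 + (1 - \<gamma>) ^ l * U / \<gamma>)"
proof -
  let ?n = "min l (t - 1)" and ?G = "markov A B C t"
  \<comment> \<open>If \<open>t - 1 \<le> l\<close>, the second set is empty and no tail
    arises.\<close>
  have split: "{1..t - 1} = {1..?n} \<union> {Suc l..t - 1}" by auto
  have "response A B C (t - 1) u t = response A B C ?n u t + (\<Sum>k = Suc l..t - 1. ?G k *v u (t - k))"
    unfolding response_def by (subst split, rule sum.union_disjoint) auto
  moreover have "response A B C l v t = response A B C ?n v t"
    using assms(1) by (rule response_le_horizon)
  ultimately have "response A B C (t - 1) u t - response A B C l v t
      = response A B C ?n (\<lambda>s. u s - v s) t + (\<Sum>k = Suc l..t - 1. ?G k *v u (t - k))"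
    by (simp only: response_diff diff_add_eq)
  also have "norm \<dots> \<le> \<kappa>a * \<kappa>b * (\<Sum>k = 1..?n. (1 - \<gamma>) ^ (k - 1) * (real k * \<delta>))
      + \<kappa>a * \<kappa>b * (\<Sum>k = Suc l..t - 1. (1 - \<gamma>) ^ (k - 1) * U)"
  proof (rule norm_triangle_mono)
    show "norm (response A B C ?n (\<lambda>s. u s - v s) t)
        \<le> \<kappa>a * \<kappa>b * (\<Sum>k = 1..?n. (1 - \<gamma>) ^ (k - 1) * (real k * \<delta>))"
      unfolding response_def by (rule norm_markov_sum_le[where v = "\<lambda>s. u s - v s"]) (auto intro!: \<delta>)
    show "norm (\<Sum>k = Suc l..t - 1. ?G k *v u (t - k))
        \<le> \<kappa>a * \<kappa>b * (\<Sum>k = Suc l..t - 1. (1 - \<gamma>) ^ (k - 1) * U)"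
      by (rule norm_markov_sum_le) (auto intro: U)
  qed
  also have "\<dots> = \<kappa>a * \<kappa>b * ((\<Sum>k = 1..?n. (1 - \<gamma>) ^ (k - 1) * real k) * \<delta>
      + (\<Sum>k = Suc l..t - 1. (1 - \<gamma>) ^ (k - 1)) * U)"
    by (simp add: sum_distrib_right distrib_left mult.assoc)
  also have "\<dots> \<le> \<kappa>a * \<kappa>b * (1 / \<gamma>\<^sup>2 * \<delta> + (1 - \<gamma>) ^ l / \<gamma> * U)"
    using pos assms(2,3)
    by (intro mult_left_mono add_mono mult_right_mono geometric_tail geometric_deriv_sum_le) auto
  finally show ?thesis by simp
qed

section \<open>Size of the inputs generated by a controller\<close>

lemma norm_wpast_le: "1 \<le> i \<Longrightarrow> norm (wpast w t i) \<le> \<kappa>w"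
  using sys pos by (auto simp: wpast_def system_ok_def)

lemma norm_dac_u_le_sum: "norm (dac_u M h w t) \<le> (\<Sum>k = 1..h. norm (M k)) * \<kappa>w"
  unfolding dac_u_def sum_distrib_right
proof (rule sum_norm_le)
  fix k assume "k \<in> {1..h}"
  then show "norm (M k *v wpast w t k) \<le> norm (M k) * \<kappa>w"
    using norm_matrix_vector_le[of "M k" "wpast w t k"] mult_left_mono[OF norm_wpast_le[of k t], of "norm (M k)"]
    by simp
qed

lemma norm_dac_u_le: "norm (dac_u M h w t) \<le> \<kappa>w * sqrt h * dacnorm h M"
proof -
  have "(\<Sum>k = 1..h. norm (M k)) * \<kappa>w \<le> (sqrt h * dacnorm h M) * \<kappa>w"
    using sum_norm_le_dacnorm pos by (intro mult_right_mono) auto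
  with norm_dac_u_le_sum have "norm (dac_u M h w t) \<le> (sqrt h * dacnorm h M) * \<kappa>w"
    by (rule order_trans)
  then show ?thesis by (simp add: mult_ac)
qed

lemma norm_dac_u_dacset_le:
  assumes "M \<in> dacset h \<kappa>M"
  shows "norm (dac_u M h w t) \<le> \<kappa>M * \<kappa>w * h"
proof -
  have "(\<Sum>k = 1..h. norm (M k)) \<le> (\<Sum>k = 1..h. \<kappa>M)"
    using assms by (intro sum_mono) (auto simp: dacset_def)
  from mult_right_mono[OF this, of \<kappa>w]
  have "(\<Sum>k = 1..h. norm (M k)) * \<kappa>w \<le> (\<Sum>k = 1..h. \<kappa>M) * \<kappa>w" using pos by simp
  with norm_dac_u_le_sum have "norm (dac_u M h w t) \<le> (\<Sum>k = 1..h. \<kappa>M) * \<kappa>w" by (rule order_trans)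
  then show ?thesis by (simp add: mult_ac)
qed

end

section \<open>Surrogate losses\<close>

locale olc_problem = lti_system \<kappa>a \<kappa>b \<kappa>w \<kappa>e \<gamma> A B C w e
  for \<kappa>a \<kappa>b \<kappa>w \<kappa>e \<gamma> :: real
    and A :: "nat \<Rightarrow> real^('n::finite)^'n" and B :: "nat \<Rightarrow> real^('m::finite)^'n"
    and C :: "nat \<Rightarrow> real^'n^('p::finite)" and w :: "nat \<Rightarrow> real^'n" and e :: "nat \<Rightarrow> real^'p" +
  fixes c :: "nat \<Rightarrow> real^'p \<Rightarrow> real^'m \<Rightarrow> real" and L G \<kappa>M :: real and h :: nat
  assumes cost: "cost_ok L G c" and \<kappa>M: "0 \<le> \<kappa>M"
begin

text \<open>Comparing a point of norm 1 with the origin forces the sign. It is what makes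
  \<open>Lf\<close> nonnegative.\<close>

lemma L_nonneg: "0 \<le> L"
proof -
  let ?y = "axis undefined 1 :: real^'p"
  have "norm (?y, 0::real^'m) = 1" by (simp add: norm_Pair)
  moreover have "\<bar>c 1 ?y 0 - c 1 0 0\<bar> \<le> L * max (max (norm (?y, 0::real^'m)) (norm (0::real^'p, 0::real^'m))) 1
      * norm ((?y, 0::real^'m) - (0, 0))"
    using cost unfolding cost_ok_def by blast
  ultimately show ?thesis by simp
qed

lemma vgrad_le:
  assumes "1 \<le> t" "0 < d" "norm y \<le> d" "norm u \<le> d"
  shows "norm (vgrad (\<lambda>y'. c t y' u) y) \<le> G * d" and "norm (vgrad (c t y) u) \<le> G * d"
proof -
  have "\<forall>d>0. \<forall>y u. norm y \<le> d \<and> norm u \<le> d \<longrightarrow>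
      norm (vgrad (\<lambda>y'. c t y' u) y) \<le> G * d \<and> norm (vgrad (c t y) u) \<le> G * d"
    using cost assms(1) unfolding cost_ok_def by simp
  with assms show "norm (vgrad (\<lambda>y'. c t y' u) y) \<le> G * d" and "norm (vgrad (c t y) u) \<le> G * d"
    by simp_all
qed

lemma G_nonneg: "0 \<le> G"
proof -
  have "norm (vgrad (c 1 0) 0) \<le> G * 1" by (rule vgrad_le) simp_all
  then show ?thesis using norm_ge_zero[of "vgrad (c 1 0) 0"] by linarith
qed

abbreviation dcost :: "nat \<Rightarrow> real^'p \<Rightarrow> real^'m \<Rightarrow> (real^'p) \<times> (real^'m) \<Rightarrow> real" where
  "dcost t y u \<equiv> frechet_derivative (\<lambda>z. c t (fst z) (snd z)) (at (y, u))"

lemma cost_has_derivative: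
  "1 \<le> t \<Longrightarrow> ((\<lambda>z. c t (fst z) (snd z)) has_derivative dcost t y u) (at (y, u))"
  using cost unfolding cost_ok_def by (simp add: frechet_derivative_works)

lemma cost_above_tangent:
  assumes "1 \<le> t"
  shows "c t y u + dcost t y u (y' - y, u' - u) \<le> c t y' u'"
  using convex_on_above_tangent[OF _ cost_has_derivative[OF assms], of y u "(y', u')"] cost assms
  by (simp add: cost_ok_def)

text \<open>The direction splits into \<open>(a, 0)\<close> and \<open>(0, b)\<close>; on each part
  the derivative is an inner product with a partial gradient, to which Cauchy-Schwarz
  applies.\<close>

lemma dcost_le:
  assumes t: "1 \<le> t" and d: "0 < d" "norm y \<le> d" "norm u \<le> d"
  shows "\<bar>dcost t y u (a, b)\<bar> \<le> G * d * (norm a + norm b)"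
proof -
  let ?f = "\<lambda>z. c t (fst z) (snd z)"
  note D = cost_has_derivative[OF t, of y u]
  interpret D: bounded_linear "dcost t y u" using D by (rule has_derivative_bounded_linear)
  have "((\<lambda>y'. (y', u)) has_derivative (\<lambda>a. (a, 0))) (at y)"
    and "((\<lambda>u'. (y, u')) has_derivative (\<lambda>b. (0, b))) (at u)"
    by (auto intro!: derivative_eq_intros)
  from diff_chain_at[OF this(1), of ?f "dcost t y u"] diff_chain_at[OF this(2), of ?f "dcost t y u"] D
  have "vgrad (\<lambda>y'. c t y' u) y \<bullet> a = dcost t y u (a, 0)" "vgrad (c t y) u \<bullet> b = dcost t y u (0, b)"
    using vgrad_inner[of "\<lambda>y'. c t y' u" "\<lambda>a. dcost t y u (a, 0)" y a]
      vgrad_inner[of "c t y" "\<lambda>b. dcost t y u (0, b)" u b] by (simp_all add: o_def)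
  then have "dcost t y u (a, b) = vgrad (\<lambda>y'. c t y' u) y \<bullet> a + vgrad (c t y) u \<bullet> b"
    using D.add[of "(a, 0)" "(0, b)"] by simp
  moreover have "\<bar>vgrad (\<lambda>y'. c t y' u) y \<bullet> a\<bar> \<le> G * d * norm a"
    by (rule order_trans[OF Cauchy_Schwarz_ineq2 mult_right_mono[OF vgrad_le(1)[OF t d]]]) simp
  moreover have "\<bar>vgrad (c t y) u \<bullet> b\<bar> \<le> G * d * norm b"
    by (rule order_trans[OF Cauchy_Schwarz_ineq2 mult_right_mono[OF vgrad_le(2)[OF t d]]]) simp
  ultimately show ?thesis by (simp add: distrib_left)
qed

text \<open>The tangent is taken at \<open>(y, u)\<close>, so only this point has to lie in the ball
  of radius \<open>d\<close>; \<open>y'\<close> is arbitrary.\<close>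

lemma cost_output_diff_le:
  assumes "1 \<le> t" "0 < d" "norm y \<le> d" "norm u \<le> d"
  shows "c t y u - c t y' u \<le> G * d * norm (y - y')"
  using cost_above_tangent[OF assms(1), of y u y' u] dcost_le[OF assms, of "y' - y" 0]
  by (simp add: norm_minus_commute)

abbreviation "\<Delta> \<equiv> Dtil \<kappa>a \<kappa>b \<kappa>w \<kappa>e \<gamma> \<kappa>M h"

lemma \<Delta>_pos: "0 < \<Delta>"
  by (simp add: Dtil_def)

text \<open>As \<open>l\<close> is free, the bound covers true and surrogate outputs alike.\<close>

lemma norm_output_le:
  assumes "1 \<le> t" "v 0 = 0" "\<And>s. norm (v s) \<le> \<kappa>M * \<kappa>w * h"
  shows "norm (noise_output A C w e t + response A B C l v t) \<le> \<Delta>"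
proof -
  have "norm (response A B C l v t) \<le> \<kappa>a * \<kappa>b * (\<kappa>M * \<kappa>w * h) / \<gamma>"
    using pos \<kappa>M by (intro norm_response_le assms) auto
  moreover have "0 \<le> \<kappa>M * \<kappa>w * h" using pos \<kappa>M by simp
  ultimately show ?thesis
    using norm_triangle_ineq[of "noise_output A C w e t" "response A B C l v t"]
      norm_noise_output_le[OF assms(1)]
    unfolding Dtil_def by (simp add: mult.assoc)
qed

lemma norm_input_le:
  assumes "M \<in> dacset h \<kappa>M"
  shows "norm (dac_u M h w t) \<le> \<Delta>"
proof -
  have "0 \<le> \<kappa>a * \<kappa>w / \<gamma> + \<kappa>e + \<kappa>a * \<kappa>b * \<kappa>M * \<kappa>w * real h / \<gamma>" using pos \<kappa>M by simp
  then show ?thesis using norm_dac_u_dacset_le[OF assms, of t] unfolding Dtil_def by linarith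
qed

section \<open>Surrogate losses as functions of the controller\<close>

abbreviation surrogate_y :: "(nat \<Rightarrow> real^'n^'m) \<Rightarrow> nat \<Rightarrow> real^'p" where
  "surrogate_y M t \<equiv> noise_output A C w e t + response A B C h (dac_u M h w) t"

abbreviation surrogate :: "nat \<Rightarrow> (nat \<Rightarrow> real^'n^'m) \<Rightarrow> real" where
  "surrogate t M \<equiv> c t (surrogate_y M t) (dac_u M h w t)"

lemma norm_surrogate_y_le:
  assumes "1 \<le> t" "M \<in> dacset h \<kappa>M"
  shows "norm (surrogate_y M t) \<le> \<Delta>"
  using assms by (intro norm_output_le dac_u_0 norm_dac_u_dacset_le)

lemma dacinner_grad_surrogate:
  assumes t: "1 \<le> t"
  shows "dacinner h (dacgrad h (surrogate t) M) N
    = dcost t (surrogate_y M t) (dac_u M h w t) (response A B C h (dac_u N h w) t, dac_u N h w t)"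
proof -
  \<comment> \<open>Contribution of the controller entry \<open>i\<close> to the pair of output and
    input; swapping the sums over lags and entries shows that these contributions add up to the
    whole pair.\<close>
  let ?\<Lambda> = "\<lambda>i X. (\<Sum>k = 1..h. markov A B C t k *v (X *v wpast w (t - k) i), X *v wpast w t i)"
  have sum: "(\<Sum>i = 1..h. ?\<Lambda> i (P i)) = (response A B C h (dac_u P h w) t, dac_u P h w t)" for P
    unfolding response_def dac_u_def linear_sum[OF matrix_vector_mul_linear]
    by (subst sum.swap) (simp add: prod_eq_iff fst_sum snd_sum)
  have lin: "linear (?\<Lambda> i)" for i
    by (rule linearI) (simp_all add: matrix_vector_mult_add_rdistrib matrix_vector_right_distrib
        sum.distrib scaleR_sum_right matrix_vector_mult_scaleR flip: scaleR_matrix_vector_assoc)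
  show ?thesis
    using dacinner_dacgrad[where f = "\<lambda>z. c t (fst z) (snd z)" and F = "surrogate t" and h = h and \<Lambda> = ?\<Lambda>
        and z = "(noise_output A C w e t, 0)" and M = M and N = N] lin cost_has_derivative[OF t]
    unfolding sum by simp
qed

text \<open>Output and input are affine in the controller, so the tangent inequality of the cost
  pulls back; the derivative there is taken towards \<open>N\<close>, hence the sign change.\<close>

lemma surrogate_above_tangent:
  assumes "1 \<le> t"
  shows "surrogate t M - surrogate t N \<le> dacinner h (dacgrad h (surrogate t) M) (\<lambda>k. M k - N k)"
proof -
  interpret D: bounded_linear "dcost t (surrogate_y M t) (dac_u M h w t)"
    using cost_has_derivative[OF assms] by (rule has_derivative_bounded_linear)
  have "dacinner h (dacgrad h (surrogate t) M) (\<lambda>k. M k - N k)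
      = - dcost t (surrogate_y M t) (dac_u M h w t) (surrogate_y N t - surrogate_y M t, dac_u N h w t - dac_u M h w t)"
    unfolding dacinner_grad_surrogate[OF assms] linear_neg[OF D.linear, symmetric] dac_u_diff[abs_def] response_diff
    by simp
  then show ?thesis
    using cost_above_tangent[OF assms, of "surrogate_y M t" "dac_u M h w t" "surrogate_y N t" "dac_u N h w t"]
    by linarith
qed

text \<open>Up to the factor \<open>sqrt h\<close>, a bound on the amplification from a controller
  to the output response and input that it causes.\<close>

abbreviation "gain \<equiv> \<kappa>a * \<kappa>b * \<kappa>w / \<gamma> + \<kappa>w"

text \<open>Testing the gradient against itself reduces this to the bound on \<^term>\<open>dcost\<close>.\<close>

lemma dacnorm_grad_surrogate_le:
  assumes t: "1 \<le> t" and M: "M \<in> dacset h \<kappa>M"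
  shows "dacnorm h (dacgrad h (surrogate t) M) \<le> G * \<Delta> * (sqrt h * gain)"
proof -
  let ?g = "dacgrad h (surrogate t) M"
  let ?n = "dacnorm h ?g"
  have u: "norm (dac_u ?g h w s) \<le> \<kappa>w * sqrt h * ?n" for s by (rule norm_dac_u_le)
  have y: "norm (response A B C h (dac_u ?g h w) t) \<le> \<kappa>a * \<kappa>b * (\<kappa>w * sqrt h * ?n) / \<gamma>"
    using pos by (intro norm_response_le u dac_u_0) (simp add: dacnorm_nonneg)
  have "?n * ?n = dcost t (surrogate_y M t) (dac_u M h w t)
      (response A B C h (dac_u ?g h w) t, dac_u ?g h w t)"
    using dacinner_grad_surrogate[OF t, of M ?g] dacnorm_power2[of h ?g]
    by (simp add: power2_eq_square)
  also have "\<dots> \<le> G * \<Delta> * (norm (response A B C h (dac_u ?g h w) t) + norm (dac_u ?g h w t))"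
    by (rule abs_le_D1[OF dcost_le[OF t \<Delta>_pos norm_surrogate_y_le[OF t M] norm_input_le[OF M]]])
  also have "\<dots> \<le> G * \<Delta> * (\<kappa>a * \<kappa>b * (\<kappa>w * sqrt h * ?n) / \<gamma> + \<kappa>w * sqrt h * ?n)"
    using G_nonneg \<Delta>_pos by (intro mult_left_mono add_mono u y) simp
  also have "\<dots> = G * \<Delta> * (sqrt h * gain) * ?n" by (simp add: algebra_simps)
  finally have "?n * ?n \<le> G * \<Delta> * (sqrt h * gain) * ?n" .
  moreover have "0 \<le> G * \<Delta> * (sqrt h * gain)" using G_nonneg \<Delta>_pos pos by simp
  ultimately show ?thesis using dacnorm_nonneg[of h ?g] by (cases "?n = 0") auto
qed

end

section \<open>Regret\<close>

text \<open>The ceiling gives \<open>h * ln (1 / (1 - \<gamma>)) \<ge> ln T\<close>, and comparing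
  logarithms yields the decay; \<open>T \<ge> 2\<close> makes \<open>ln T\<close> positive, hence
  \<open>h \<ge> 1\<close>.\<close>

lemma mem_len_bounds:
  assumes "0 < \<gamma>" "\<gamma> < 1" "2 \<le> T"
  shows "1 \<le> mem_len \<gamma> T"
    and "(1 - \<gamma>) ^ mem_len \<gamma> T \<le> 1 / real T"
proof -
  let ?q = "ln (1 / (1 - \<gamma>))" and ?h = "mem_len \<gamma> T"
  have q: "0 < ?q" using assms by simp
  have T: "0 < ln (real T)" using assms by simp
  have le: "ln (real T) / ?q \<le> real ?h" unfolding mem_len_def by (rule real_nat_ceiling_ge)
  have "0 < ln (real T) / ?q" using q T by simp
  with le have "0 < real ?h" by linarith
  then show "1 \<le> ?h" by simp
  have "ln ((1 - \<gamma>) ^ ?h) = - (real ?h * ?q)"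
    using assms by (simp add: ln_realpow ln_div)
  also have "\<dots> \<le> - ln (real T)"
    using le unfolding pos_divide_le_eq[OF q] by simp
  also have "\<dots> = ln (1 / real T)" using assms by (simp add: ln_div)
  finally show "(1 - \<gamma>) ^ ?h \<le> 1 / real T"
    using assms by simp
qed

context olc_problem
begin

text \<open>Here \<open>\<delta>\<close> is the drift of the controller per step, zero for a fixed
  policy. The estimates \<open>sqrt h \<le> h\<close> and
  \<open>\<kappa>a * \<kappa>b * \<kappa>w / \<gamma> \<le> gain\<close> express everything through
  \<open>g\<close>, and the decay turns the tail into \<open>\<kappa>M / T\<close>.\<close>

lemma truncation_cost_le:
  assumes "1 \<le> h" "(1 - \<gamma>) ^ h \<le> 1 / real T" "G * \<Delta> * (real h * gain) \<le> g" "0 \<le> \<delta>"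
  shows "G * \<Delta> * (\<kappa>a * \<kappa>b * ((\<kappa>w * sqrt h * \<delta>) / \<gamma>\<^sup>2 + (1 - \<gamma>) ^ h * (\<kappa>M * \<kappa>w * h) / \<gamma>))
    \<le> g * (\<delta> / \<gamma> + \<kappa>M / T)"
proof -
  let ?q = "\<kappa>a * \<kappa>b * \<kappa>w / \<gamma>"
  have nonneg: "0 \<le> G * \<Delta>" "0 \<le> ?q" using G_nonneg \<Delta>_pos pos by simp_all
  have "sqrt (real h) \<le> real h"
    using assms(1) by (intro real_le_lsqrt) (auto simp: power2_eq_square)
  then have h: "sqrt (real h) * (\<delta> / \<gamma>) \<le> real h * (\<delta> / \<gamma>)"
    using assms(4) pos by (intro mult_right_mono) auto
  have T: "real h * \<kappa>M * (1 - \<gamma>) ^ h \<le> real h * \<kappa>M * (1 / T)"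
    using assms(2) \<kappa>M by (intro mult_left_mono) auto
  have "G * \<Delta> * (\<kappa>a * \<kappa>b * ((\<kappa>w * sqrt h * \<delta>) / \<gamma>\<^sup>2 + (1 - \<gamma>) ^ h * (\<kappa>M * \<kappa>w * h) / \<gamma>))
      = G * \<Delta> * (?q * (sqrt h * (\<delta> / \<gamma>) + h * \<kappa>M * (1 - \<gamma>) ^ h))"
    using pos by (simp add: field_simps power2_eq_square)
  also have "\<dots> \<le> G * \<Delta> * (?q * (h * (\<delta> / \<gamma>) + h * \<kappa>M * (1 / T)))"
    by (rule mult_left_mono[OF mult_left_mono[OF add_mono[OF h T]]]) (use nonneg in auto)
  also have "\<dots> = G * \<Delta> * (h * ?q) * (\<delta> / \<gamma> + \<kappa>M / T)"
    by (simp add: algebra_simps add_divide_distrib)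
  also have "\<dots> \<le> g * (\<delta> / \<gamma> + \<kappa>M / T)"
  proof (rule mult_right_mono)
    have "G * \<Delta> * (h * ?q) \<le> G * \<Delta> * (h * gain)"
      using nonneg pos by (intro mult_left_mono) auto
    with assms(3) show "G * \<Delta> * (h * ?q) \<le> g" by linarith
    show "0 \<le> \<delta> / \<gamma> + \<kappa>M / T" using pos \<kappa>M assms(4) by simp
  qed
  finally show ?thesis .
qed

text \<open>\<open>g\<close> stands for \<open>Gf\<close> and \<open>Q\<close> for
  \<open>Gf * (Gf + Lf * h\<^sup>2)\<close>; the two are linked by
  \<open>g\<^sup>2 \<le> Q\<close>.\<close>

lemma regret_le:
  fixes Ms :: "nat \<Rightarrow> nat \<Rightarrow> real^'n^'m"
  defines "D \<equiv> dac_diam h \<kappa>M TYPE('n) TYPE('m)"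
  assumes h: "1 \<le> h" and T: "1 \<le> T" and decay: "(1 - \<gamma>) ^ h \<le> 1 / real T"
    and g: "G * \<Delta> * (real h * gain) \<le> g" and Q: "g\<^sup>2 \<le> Q"
    and run: "olc_run h \<kappa>M (D / sqrt (Q * T)) A B C w e c Ms"
  shows "regret T h \<kappa>M A B C w e c Ms \<le> (2 + 1 / \<gamma>) * (D * sqrt Q * sqrt T)"
proof -
  define \<eta> where "\<eta> = D / sqrt (Q * T)"
  have D: "2 * \<kappa>M \<le> D" unfolding D_def using h \<kappa>M by (rule diam_ge)
  have g0: "0 \<le> g"
    using g G_nonneg \<Delta>_pos pos by (intro order_trans[OF _ g]) simp
  have Q0: "0 \<le> Q" using Q by (rule order_trans[rotated]) simp
  have \<eta>0: "0 \<le> \<eta>" unfolding \<eta>_def using D \<kappa>M Q0 by simp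
  have init: "Ms 1 \<in> dacset h \<kappa>M" using run by (simp add: olc_run_def)
  \<comment> \<open>By \<open>olc_F_eq\<close> the run of the algorithm is projected descent along
    the gradients of the surrogates.\<close>
  interpret projected_descent h \<kappa>M \<eta> g "\<lambda>t. dacgrad h (surrogate t) (Ms t)" Ms
  proof
    fix t :: nat assume t: "1 \<le> t"
    then show "Ms (Suc t) = dac_proj h \<kappa>M (\<lambda>k. Ms t k - \<eta> *\<^sub>R dacgrad h (surrogate t) (Ms t) k)"
      using run by (simp add: olc_run_def \<eta>_def olc_F_eq[abs_def])
    assume "Ms t \<in> dacset h \<kappa>M"
    note dacnorm_grad_surrogate_le[OF t this]
    also have "sqrt (real h) \<le> real h"
      using h by (intro real_le_lsqrt) (auto simp: power2_eq_square)
    then have "G * \<Delta> * (sqrt h * gain) \<le> G * \<Delta> * (h * gain)"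
      using G_nonneg \<Delta>_pos pos by (intro mult_left_mono mult_right_mono) auto
    also note g
    finally show "dacnorm h (dacgrad h (surrogate t) (Ms t)) \<le> g" .
  qed (use \<kappa>M \<eta>0 init in auto)
  have alg_u0: "alg_u h w Ms 0 = 0" by (simp add: alg_u_def dac_u_0)
  have alg_u: "norm (alg_u h w Ms s) \<le> \<kappa>M * \<kappa>w * h" for s
  proof (cases "s = 0")
    case True
    then show ?thesis using pos \<kappa>M by (simp add: alg_u0)
  next
    case False
    then show ?thesis unfolding alg_u_def by (intro norm_dac_u_dacset_le iterate_in) simp
  qed
  have U: "0 \<le> \<kappa>M * \<kappa>w * h" using \<kappa>M pos by simp
  \<comment> \<open>The controller \<open>k\<close> steps ago is within
    \<open>k * \<eta> * g\<close> of the current one, so the inputs at lag \<open>k\<close> differ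
    by at most \<open>\<kappa>w * sqrt h\<close> times this.\<close>
  have memory: "c t (alg_y h A B C w e Ms t) (alg_u h w Ms t) - surrogate t (Ms t)
      \<le> g * (\<eta> * g / \<gamma> + \<kappa>M / T)" if t: "1 \<le> t" for t
  proof -
    have "c t (alg_y h A B C w e Ms t) (alg_u h w Ms t) - surrogate t (Ms t)
        \<le> G * \<Delta> * norm (alg_y h A B C w e Ms t - surrogate_y (Ms t) t)"
      unfolding alg_u_def[of h w Ms t]
    proof (rule cost_output_diff_le[OF t \<Delta>_pos])
      show "norm (alg_y h A B C w e Ms t) \<le> \<Delta>"
        unfolding alg_y_eq using t alg_u0 alg_u by (rule norm_output_le)
      show "norm (dac_u (Ms t) h w t) \<le> \<Delta>" using iterate_in[OF t] by (rule norm_input_le)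
    qed
    also have "alg_y h A B C w e Ms t - surrogate_y (Ms t) t
        = response A B C (t - 1) (alg_u h w Ms) t - response A B C h (dac_u (Ms t) h w) t"
      by (simp add: alg_y_eq)
    also have "G * \<Delta> * norm \<dots> \<le> G * \<Delta> * (\<kappa>a * \<kappa>b * ((\<kappa>w * sqrt h * (\<eta> * g)) / \<gamma>\<^sup>2
        + (1 - \<gamma>) ^ h * (\<kappa>M * \<kappa>w * h) / \<gamma>))"
    proof (intro mult_left_mono response_truncation_le dac_u_0 U alg_u)
      show "0 \<le> \<kappa>w * sqrt h * (\<eta> * g)" using pos \<eta>0 g0 by simp
      fix k assume k: "1 \<le> k" "k < t"
      have "alg_u h w Ms (t - k) - dac_u (Ms t) h w (t - k) = dac_u (\<lambda>i. Ms (t - k) i - Ms t i) h w (t - k)"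
        by (simp add: alg_u_def dac_u_diff)
      also have "norm \<dots> \<le> \<kappa>w * sqrt h * dacnorm h (\<lambda>i. Ms (t - k) i - Ms t i)"
        by (rule norm_dac_u_le)
      also have "\<dots> \<le> \<kappa>w * sqrt h * (real k * (\<eta> * g))"
      proof (rule mult_left_mono)
        show "dacnorm h (\<lambda>i. Ms (t - k) i - Ms t i) \<le> real k * (\<eta> * g)"
          using drift[of "t - k" k] k by (simp add: dacnorm_commute)
      qed (use pos in simp)
      finally show "norm (alg_u h w Ms (t - k) - dac_u (Ms t) h w (t - k)) \<le> real k * (\<kappa>w * sqrt h * (\<eta> * g))"
        by (simp add: mult_ac)
    qed (use G_nonneg \<Delta>_pos in simp)
    also have "\<dots> \<le> g * (\<eta> * g / \<gamma> + \<kappa>M / T)"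
      using \<eta>0 g0 by (intro truncation_cost_le h decay g) simp
    finally show ?thesis .
  qed
  \<comment> \<open>Both sides use the same controller, so there is no drift and
    \<open>\<delta> = 0\<close>; only the tail beyond \<open>h\<close> contributes.\<close>
  have comparator: "surrogate t Z - c t (pol_y h A B C w e Z t) (pol_u h w Z t) \<le> g * (\<kappa>M / T)"
    if t: "1 \<le> t" and Z: "Z \<in> dacset h \<kappa>M" for t Z
  proof -
    have "surrogate t Z - c t (pol_y h A B C w e Z t) (pol_u h w Z t)
        \<le> G * \<Delta> * norm (surrogate_y Z t - pol_y h A B C w e Z t)"
      unfolding pol_u_def
      by (rule cost_output_diff_le[OF t \<Delta>_pos norm_surrogate_y_le[OF t Z] norm_input_le[OF Z]])
    also have "norm (surrogate_y Z t - pol_y h A B C w e Z t)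
        = norm (response A B C (t - 1) (dac_u Z h w) t - response A B C h (dac_u Z h w) t)"
      by (simp add: pol_y_eq norm_minus_commute)
    also have "G * \<Delta> * \<dots> \<le> G * \<Delta> * (\<kappa>a * \<kappa>b * ((\<kappa>w * sqrt h * 0) / \<gamma>\<^sup>2
        + (1 - \<gamma>) ^ h * (\<kappa>M * \<kappa>w * h) / \<gamma>))"
      using G_nonneg \<Delta>_pos
      by (intro mult_left_mono response_truncation_le dac_u_0 U norm_dac_u_dacset_le Z) simp_all
    also have "\<dots> \<le> g * (0 / \<gamma> + \<kappa>M / T)"
      by (intro truncation_cost_le h decay g) simp
    finally show ?thesis by simp
  qed
  define s r where "s = sqrt Q" and "r = sqrt T"
  have gs: "g \<le> s" unfolding s_def using Q by (rule real_le_rsqrt)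
  have s: "0 \<le> s" "g\<^sup>2 \<le> s * s" unfolding s_def using Q Q0 by simp_all
  have r: "1 \<le> r" "T = r * r" unfolding r_def using T by simp_all
  have \<eta>: "\<eta> = D / (s * r)" by (simp add: \<eta>_def s_def r_def real_sqrt_mult)
  have D0: "0 \<le> D" using D \<kappa>M by simp
  have descent: "(\<Sum>t = 1..T. dacinner h (dacgrad h (surrogate t) (Ms t)) (\<lambda>k. Ms t k - Z k)) \<le> D * s * r"
    and drift_cost: "T * (g * (\<eta> * g / \<gamma>)) \<le> 1 / \<gamma> * (D * s * r)"
    if Z: "Z \<in> dacset h \<kappa>M" for Z
  proof -
    have eg: "\<eta> * T * g\<^sup>2 \<le> D * s * r"
    \<comment> \<open>If \<open>g = 0\<close>, then \<open>s\<close> may be 0 and the division by it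
      is meaningless; otherwise \<open>s > 0\<close> and the claim follows from
      \<open>g\<^sup>2 \<le> s * s\<close>.\<close>
    proof (cases "g = 0")
      case True
      then show ?thesis using D0 s(1) r(1) by simp
    next
      case False
      then have "0 < s" using g0 gs by linarith
      have "\<eta> * T * g\<^sup>2 = D * r * (g\<^sup>2 / s)"
        unfolding \<eta> r(2) using \<open>0 < s\<close> r(1) by (simp add: field_simps)
      also have "g\<^sup>2 / s \<le> s" using \<open>0 < s\<close> s(2) by (simp add: pos_divide_le_eq)
      then have "D * r * (g\<^sup>2 / s) \<le> D * r * s" using D0 r(1) by (intro mult_left_mono) auto
      finally show ?thesis by (simp add: mult_ac)
    qed
    then show "T * (g * (\<eta> * g / \<gamma>)) \<le> 1 / \<gamma> * (D * s * r)"
      using pos by (simp add: field_simps power2_eq_square)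
    show "(\<Sum>t = 1..T. dacinner h (dacgrad h (surrogate t) (Ms t)) (\<lambda>k. Ms t k - Z k)) \<le> D * s * r"
    \<comment> \<open>In the degenerate case \<open>\<eta>\<close> may be 0, so
      \<open>descent_regret\<close> is out of reach; instead Cauchy-Schwarz bounds each summand by
      \<open>g * D = 0\<close>.\<close>
    proof (cases "D * g = 0")
      case True
      have "(\<Sum>t = 1..T. dacinner h (dacgrad h (surrogate t) (Ms t)) (\<lambda>k. Ms t k - Z k)) \<le> (\<Sum>t = 1..T. g * D)"
      proof (rule sum_mono)
        fix t assume "t \<in> {1..T}"
        then have "1 \<le> t" by simp
        then have "dacnorm h (dacgrad h (surrogate t) (Ms t)) * dacnorm h (\<lambda>k. Ms t k - Z k) \<le> g * D"
          unfolding D_def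
          by (intro mult_mono grad_le dacnorm_diff_le_diam iterate_in Z g0 dacnorm_nonneg)
        then show "dacinner h (dacgrad h (surrogate t) (Ms t)) (\<lambda>k. Ms t k - Z k) \<le> g * D"
          by (rule order_trans[OF dacinner_le])
      qed
      also have "\<dots> = 0" using True by auto
      also have "\<dots> \<le> D * s * r" using D0 s(1) r(1) by simp
      finally show ?thesis .
    next
      case False
      then have "0 < D" and "0 < s" using D0 g0 gs by auto
      then have \<eta>pos: "0 < \<eta>" and \<eta>D: "D\<^sup>2 / \<eta> = D * s * r"
        unfolding \<eta> using r(1) by (simp_all add: power2_eq_square)
      \<comment> \<open>Each of the two terms of \<open>descent_regret\<close> is at most half of
        \<open>D * s * r\<close>.\<close>
      have "D\<^sup>2 / (2 * \<eta>) = D\<^sup>2 / \<eta> / 2" by simp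
      then show ?thesis
        using descent_regret[OF Z \<eta>pos, of T] eg \<eta>D unfolding D_def[symmetric] by linarith
    qed
  qed
  \<comment> \<open>The constant collects 1 from descent, \<open>1 / \<gamma>\<close> from drift,
    and 1 from the two tails, which together cost \<open>g * (2 * \<kappa>M)\<close>. The form with
    the comparator alone on the right prepares for the infimum.\<close>
  have "(\<Sum>t = 1..T. c t (alg_y h A B C w e Ms t) (alg_u h w Ms t)) - (2 + 1 / \<gamma>) * (D * s * r)
      \<le> (\<Sum>t = 1..T. c t (pol_y h A B C w e Z t) (pol_u h w Z t))" if Z: "Z \<in> dacset h \<kappa>M" for Z
  proof -
    let ?i = "\<lambda>t. dacinner h (dacgrad h (surrogate t) (Ms t)) (\<lambda>k. Ms t k - Z k)"
    have "(\<Sum>t = 1..T. c t (alg_y h A B C w e Ms t) (alg_u h w Ms t) - c t (pol_y h A B C w e Z t) (pol_u h w Z t))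
        \<le> (\<Sum>t = 1..T. g * (\<eta> * g / \<gamma> + \<kappa>M / T) + ?i t + g * (\<kappa>M / T))"
    proof (rule sum_mono)
      fix t assume "t \<in> {1..T}"
      then have t: "1 \<le> t" by simp
      show "c t (alg_y h A B C w e Ms t) (alg_u h w Ms t) - c t (pol_y h A B C w e Z t) (pol_u h w Z t)
          \<le> g * (\<eta> * g / \<gamma> + \<kappa>M / T) + ?i t + g * (\<kappa>M / T)"
        using memory[OF t] surrogate_above_tangent[OF t, of "Ms t" Z] comparator[OF t Z] by linarith
    qed
    also have "\<dots> = T * (g * (\<eta> * g / \<gamma>)) + (\<Sum>t = 1..T. ?i t) + g * (2 * \<kappa>M)"
      using T by (simp add: sum.distrib distrib_left)
    also have "g * (2 * \<kappa>M) \<le> D * s * r"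
    proof -
      have "g * (2 * \<kappa>M) \<le> s * D" using D \<kappa>M gs s(1) by (intro mult_mono) auto
      also have "\<dots> \<le> s * D * r" using D0 s(1) mult_left_mono[OF r(1), of "s * D"] by simp
      finally show ?thesis by (simp add: mult_ac)
    qed
    finally show ?thesis
      using descent[OF Z] drift_cost[OF Z] by (simp add: sum_subtractf distrib_right)
  qed
  then have "(\<Sum>t = 1..T. c t (alg_y h A B C w e Ms t) (alg_u h w Ms t)) - (2 + 1 / \<gamma>) * (D * s * r)
      \<le> (INF Z \<in> dacset h \<kappa>M. \<Sum>t = 1..T. c t (pol_y h A B C w e Z t) (pol_u h w Z t))"
    \<comment> \<open>\<open>Ms 1\<close> witnesses that the comparator class is nonempty.\<close>
    using init by (intro cINF_greatest) auto
  then show ?thesis by (simp add: regret_def s_def r_def)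
qed

end

theorem theorem1:
  fixes \<kappa>a \<kappa>b \<kappa>w \<kappa>e \<gamma> \<kappa>M L G :: real
  assumes "\<kappa>a > 0" and "\<kappa>b > 0" and "\<kappa>w > 0" and "\<kappa>e > 0"
    and "0 < \<gamma>" and "\<gamma> < 1"
  shows "\<exists>K::real. \<forall>T::nat. T \<ge> 3 \<longrightarrow>
    (\<forall>(A :: nat \<Rightarrow> real^'n^'n) (B :: nat \<Rightarrow> real^'m^'n) (C :: nat \<Rightarrow> real^'n^'p)
      (w :: nat \<Rightarrow> real^'n) (e :: nat \<Rightarrow> real^'p) (c :: nat \<Rightarrow> real^'p \<Rightarrow> real^'m \<Rightarrow> real)
      (Ms :: nat \<Rightarrow> nat \<Rightarrow> real^'n^'m).
      let h = mem_len \<gamma> T;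
          D = dac_diam h \<kappa>M TYPE('n) TYPE('m);
          Lf' = Lf L \<kappa>a \<kappa>b \<kappa>w \<kappa>e \<gamma> \<kappa>M h;
          Gf' = Gf G \<kappa>a \<kappa>b \<kappa>w \<kappa>e \<gamma> \<kappa>M h CARD('n) CARD('m);
          \<eta> = D / sqrt (Gf' * (Gf' + Lf' * (real h)\<^sup>2) * real T)
      in system_ok \<kappa>a \<kappa>b \<kappa>w \<kappa>e \<gamma> A B C w e \<and> cost_ok L G c \<and>
         olc_run h \<kappa>M \<eta> A B C w e c Ms \<longrightarrow>
         regret T h \<kappa>M A B C w e c Ms \<le> K * (D * sqrt (Gf' * (Gf' + Lf' * (real h)\<^sup>2)) * sqrt (real T)))"
  unfolding Let_def
proof (intro exI[of _ "2 + 1 / \<gamma>"] allI impI, elim conjE)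
  fix T :: nat
    and A :: "nat \<Rightarrow> real^'n^'n" and B :: "nat \<Rightarrow> real^'m^'n" and C :: "nat \<Rightarrow> real^'n^'p"
    and w :: "nat \<Rightarrow> real^'n" and e :: "nat \<Rightarrow> real^'p" and c :: "nat \<Rightarrow> real^'p \<Rightarrow> real^'m \<Rightarrow> real"
    and Ms :: "nat \<Rightarrow> nat \<Rightarrow> real^'n^'m"
  let ?h = "mem_len \<gamma> T"
  let ?D = "dac_diam ?h \<kappa>M TYPE('n) TYPE('m)"
    and ?L = "Lf L \<kappa>a \<kappa>b \<kappa>w \<kappa>e \<gamma> \<kappa>M ?h"
    and ?g = "Gf G \<kappa>a \<kappa>b \<kappa>w \<kappa>e \<gamma> \<kappa>M ?h CARD('n) CARD('m)"
  let ?Q = "?g * (?g + ?L * (real ?h)\<^sup>2)"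
  assume T: "3 \<le> T" and sys: "system_ok \<kappa>a \<kappa>b \<kappa>w \<kappa>e \<gamma> A B C w e" and cost: "cost_ok L G c"
    and run: "olc_run ?h \<kappa>M (?D / sqrt (?Q * real T)) A B C w e c Ms"
  have h: "1 \<le> ?h" and decay: "(1 - \<gamma>) ^ ?h \<le> 1 / real T"
    using mem_len_bounds[OF assms(5,6), of T] T by simp_all
  \<comment> \<open>The sign of \<open>\<kappa>M\<close> is read off from the initial controller,
    whose entry 1 is constrained because \<open>h \<ge> 1\<close>.\<close>
  have "norm (Ms 1 1) \<le> \<kappa>M" using run h by (simp add: olc_run_def dacset_def)
  then have "0 \<le> \<kappa>M" by (rule order_trans[OF norm_ge_zero])
  then interpret olc_problem \<kappa>a \<kappa>b \<kappa>w \<kappa>e \<gamma> A B C w e c L G \<kappa>M ?h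
    using assms sys cost by unfold_locales auto
  have nonneg: "0 \<le> G * \<Delta> * (real ?h * gain)" using G_nonneg \<Delta>_pos assms by simp
  \<comment> \<open>The dimension factors in \<open>Gf\<close> only enlarge it, so \<open>Gf\<close>
    is a valid gradient bound.\<close>
  have "1 \<le> real CARD('n) * real CARD('m)"
    using mult_mono[of 1 "real CARD('n)" 1 "real CARD('m)"] by (simp add: Suc_leI)
  from mult_left_mono[OF this nonneg]
  have g: "G * \<Delta> * (real ?h * gain) \<le> ?g" by (simp add: Gf_def mult_ac)
  have "0 \<le> ?L" using L_nonneg \<Delta>_pos assms by (simp add: Lf_def)
  then have "?g * ?g \<le> ?Q" using nonneg g by (intro mult_left_mono) auto
  then show "regret T ?h \<kappa>M A B C w e c Ms \<le> (2 + 1 / \<gamma>) * (?D * sqrt ?Q * sqrt (real T))"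
    using T by (intro regret_le[OF h _ decay g _ run]) (simp_all add: power2_eq_square)
qed

end
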